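(* For every positive integer $n$, the semilattice $(\mathcal{T}_{nq}(\mathbb{Z}^n),\vee)$ is isomorphic to the semilattice $\mathcal{L}_n$ of linear subspaces of $\mathbb{R}^n$ with operation $(L_1,L_2)\mapsto L_1+L_2$.
   Context: $\mathbb{Z}^n$ is the discrete free abelian group of rank $n$. For a locally compact group $G$, $\mathcal{T}(G)$ is the set of all topologies on $G$ of the form $\eta^{-1}(\tau_H)=\{\eta^{-1}(U):U\in\tau_H\}$, where $H$ is a locally compact group and $\eta:G\to H$ a continuous homomorphism. For $\tau\in\mathcal{T}(G)$, $(\eta_\tau,G_\tau)$ denotes the pair, unique up to isomorphism, where $G_\tau$ is a locally compact group, $\eta_\tau:G\to G_\tau$ is a continuous homomorphism with dense range, and $\tau=\eta_\tau^{-1}(\tau_{G_\tau})$. If $\tau_1\subseteq\tau_2$, $\eta^{\tau_2}_{\tau_1}:G_{\tau_2}\to G_{\tau_1}$ is the unique continuous homomorphism with $\eta^{\tau_2}_{\tau_1}\circ\eta_{\tau_2}=\eta_{\tau_1}$. $\tau_1\vee\tau_2$ is the coarsest topology making both $\eta_{\tau_1},\eta_{\tau_2}$ continuous. $\tau$ is a quotient of $\tau_1$ if $\tau\subseteq\tau_1$ and $\eta^{\tau_1}_\tau$ is proper (preimages of compact sets are compact); it is non-trivial if $\tau\ne\tau_1$. $\mathcal{T}_{nq}(G)$ is the set of $\tau\in\mathcal{T}(G)$ which are not a non-trivial quotient of any $\tau_1\in\mathcal{T}(G)$; for abelian $G$ it is closed under $\vee$. A semilattice is a commutative idempotent semigroup.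 *)

theory Defs
  imports "HOL-Analysis.Analysis" "HOL-Algebra.Elementary_Groups"
begin

definition topological_group :: "('a, 'm) monoid_scheme \<Rightarrow> 'a topology \<Rightarrow> bool" where
  "topological_group G T \<longleftrightarrow>
     group G \<and> topspace T = carrier G \<and>
     continuous_map (prod_topology T T) T (\<lambda>(x, y). x \<otimes>\<^bsub>G\<^esub> y) \<and>
     continuous_map T T (\<lambda>x. inv\<^bsub>G\<^esub> x)"

text \<open>As usual, a locally compact group is Hausdorff by convention.\<close>

definition locally_compact_group :: "('a, 'm) monoid_scheme \<Rightarrow> 'a topology \<Rightarrow> bool" where
  "locally_compact_group G T \<longleftrightarrow>
     topological_group G T \<and> Hausdorff_space T \<and> locally_compact_space T"

definition continuous_hom ::
    "('a, 'm) monoid_scheme \<Rightarrow> 'a topology \<Rightarrow> ('b, 'k) monoid_scheme \<Rightarrow> 'b topology \<Rightarrow> ('a \<Rightarrow> 'b) \<Rightarrow> bool" where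
  "continuous_hom G TG H TH \<eta> \<longleftrightarrow> \<eta> \<in> hom G H \<and> continuous_map TG TH \<eta>"

text \<open>The target groups \<open>H\<close> range over groups carried by subsets of the type \<open>'a set set\<close>, where
  \<open>'a\<close> is the type of elements of \<open>G\<close>. This is no restriction: \<open>H\<close> may be replaced by the closure
  of the image of \<open>G\<close>, and a point \<open>x\<close> of a Hausdorff space in which \<open>\<eta> ` G\<close> is dense is determined by
  the sets \<open>\<eta> -` U\<close>, \<open>U\<close> an open neighbourhood of \<open>x\<close>. The theorems \<open>lc_topologies_universal\<close> and
  \<open>lc_topologies_iff_dense_pair\<close> below make this precise.\<close>

definition lc_topologies :: "('a, 'm) monoid_scheme \<Rightarrow> 'a topology \<Rightarrow> 'a topology set" where
  "lc_topologies G TG =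
     {pullback_topology (carrier G) \<eta> TH | (H :: 'a set set monoid) TH \<eta>.
        locally_compact_group H TH \<and> continuous_hom G TG H TH \<eta>}"

text \<open>\<open>dense_pair G TG \<tau> H TH \<eta>\<close> says that \<open>(\<eta>, H)\<close> is (a representative of) the pair
  \<open>(\<eta>\<^sub>\<tau>, G\<^sub>\<tau>)\<close>.\<close>

definition dense_pair ::
    "('a, 'm) monoid_scheme \<Rightarrow> 'a topology \<Rightarrow> 'a topology \<Rightarrow>
     ('b, 'k) monoid_scheme \<Rightarrow> 'b topology \<Rightarrow> ('a \<Rightarrow> 'b) \<Rightarrow> bool" where
  "dense_pair G TG \<tau> H TH \<eta> \<longleftrightarrow>
     locally_compact_group H TH \<and> continuous_hom G TG H TH \<eta> \<and>
     TH closure_of (\<eta> ` carrier G) = carrier H \<and>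
     \<tau> = pullback_topology (carrier G) \<eta> TH"

definition coarser :: "'a topology \<Rightarrow> 'a topology \<Rightarrow> bool" where
  "coarser \<tau> \<tau>' \<longleftrightarrow> {U. openin \<tau> U} \<subseteq> {U. openin \<tau>' U}"

text \<open>\<^const>\<open>proper_map\<close> is a different notion in general (closed with compact fibres).\<close>

definition compact_preimages :: "'a topology \<Rightarrow> 'b topology \<Rightarrow> ('a \<Rightarrow> 'b) \<Rightarrow> bool" where
  "compact_preimages X Y f \<longleftrightarrow> (\<forall>K. compactin Y K \<longrightarrow> compactin X {x \<in> topspace X. f x \<in> K})"

text \<open>The pairs for \<open>\<tau>\<close> and \<open>\<tau>\<^sub>1\<close> are unique up to isomorphism and the connecting homomorphism \<open>f\<close>
  is determined by them (the image of \<open>G\<close> is dense and the target is Hausdorff), so that it does not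
  matter which representatives witness the existential quantifier.\<close>

definition lc_quotient ::
    "('a, 'm) monoid_scheme \<Rightarrow> 'a topology \<Rightarrow> 'a topology \<Rightarrow> 'a topology \<Rightarrow> bool" where
  "lc_quotient G TG \<tau> \<tau>\<^sub>1 \<longleftrightarrow>
     coarser \<tau> \<tau>\<^sub>1 \<and>
     (\<exists>(H :: 'a set set monoid) TH \<eta> (H\<^sub>1 :: 'a set set monoid) TH\<^sub>1 \<eta>\<^sub>1 f.
        dense_pair G TG \<tau> H TH \<eta> \<and> dense_pair G TG \<tau>\<^sub>1 H\<^sub>1 TH\<^sub>1 \<eta>\<^sub>1 \<and>
        continuous_hom H\<^sub>1 TH\<^sub>1 H TH f \<and> (\<forall>x\<in>carrier G. f (\<eta>\<^sub>1 x) = \<eta> x) \<and>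
        compact_preimages TH\<^sub>1 TH f)"

definition nq_topologies :: "('a, 'm) monoid_scheme \<Rightarrow> 'a topology \<Rightarrow> 'a topology set" where
  "nq_topologies G TG =
     {\<tau> \<in> lc_topologies G TG. \<not> (\<exists>\<tau>\<^sub>1 \<in> lc_topologies G TG. lc_quotient G TG \<tau> \<tau>\<^sub>1 \<and> \<tau> \<noteq> \<tau>\<^sub>1)}"

text \<open>The coarsest topology containing \<open>\<tau>\<^sub>1\<close> and \<open>\<tau>\<^sub>2\<close>; by \<open>continuous_map_dense_pair_iff\<close> below this
  is the coarsest one for which both \<open>\<eta>\<^sub>\<tau>\<^sub>1\<close> and \<open>\<eta>\<^sub>\<tau>\<^sub>2\<close> are continuous.\<close>

definition topology_join :: "'a topology \<Rightarrow> 'a topology \<Rightarrow> 'a topology" where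
  "topology_join \<tau>\<^sub>1 \<tau>\<^sub>2 = topology_generated_by ({U. openin \<tau>\<^sub>1 U} \<union> {U. openin \<tau>\<^sub>2 U})"

definition semilattice_on :: "'a set \<Rightarrow> ('a \<Rightarrow> 'a \<Rightarrow> 'a) \<Rightarrow> bool" where
  "semilattice_on A f \<longleftrightarrow>
     (\<forall>x\<in>A. \<forall>y\<in>A. f x y \<in> A) \<and>
     (\<forall>x\<in>A. \<forall>y\<in>A. \<forall>z\<in>A. f (f x y) z = f x (f y z)) \<and>
     (\<forall>x\<in>A. \<forall>y\<in>A. f x y = f y x) \<and>
     (\<forall>x\<in>A. f x x = x)"

definition semilattice_isomorphic ::
    "'a set \<Rightarrow> ('a \<Rightarrow> 'a \<Rightarrow> 'a) \<Rightarrow> 'b set \<Rightarrow> ('b \<Rightarrow> 'b \<Rightarrow> 'b) \<Rightarrow> bool" where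
  "semilattice_isomorphic A f B g \<longleftrightarrow>
     semilattice_on A f \<and> semilattice_on B g \<and>
     (\<exists>\<phi>. bij_betw \<phi> A B \<and> (\<forall>x\<in>A. \<forall>y\<in>A. \<phi> (f x y) = g (\<phi> x) (\<phi> y)))"

definition int_vec_group :: "(int ^ 'n) monoid" where
  "int_vec_group = \<lparr>carrier = UNIV, monoid.mult = (+), one = 0\<rparr>"

definition subspace_sum :: "('v :: real_vector) set \<Rightarrow> 'v set \<Rightarrow> 'v set" where
  "subspace_sum L\<^sub>1 L\<^sub>2 = {x + y | x y. x \<in> L\<^sub>1 \<and> y \<in> L\<^sub>2}"

lemma continuous_map_dense_pair_iff:
  assumes "dense_pair G TG \<tau> H TH \<eta>" and \<sigma>: "topspace \<sigma> = carrier G"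
  shows "continuous_map \<sigma> TH \<eta> \<longleftrightarrow> coarser \<tau> \<sigma>"
proof -
  have sp: "topspace TH = carrier H" and \<eta>: "\<eta> \<in> carrier G \<rightarrow> carrier H"
    and \<tau>: "\<tau> = pullback_topology (carrier G) \<eta> TH"
    using assms(1)
    by (auto simp: dense_pair_def locally_compact_group_def topological_group_def
        continuous_hom_def hom_def)
  have *: "{x \<in> carrier G. \<eta> x \<in> U} = \<eta> -` U \<inter> carrier G" for U
    by auto
  show ?thesis
    using sp \<eta> unfolding continuous_map_def coarser_def \<tau> openin_pullback_topology \<sigma> * by auto
qed

lemma topology_join_coarsest:
  "coarser \<tau>\<^sub>1 (topology_join \<tau>\<^sub>1 \<tau>\<^sub>2)" "coarser \<tau>\<^sub>2 (topology_join \<tau>\<^sub>1 \<tau>\<^sub>2)"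
  "coarser \<tau>\<^sub>1 \<sigma> \<Longrightarrow> coarser \<tau>\<^sub>2 \<sigma> \<Longrightarrow> coarser (topology_join \<tau>\<^sub>1 \<tau>\<^sub>2) \<sigma>"
proof -
  show "coarser \<tau>\<^sub>1 (topology_join \<tau>\<^sub>1 \<tau>\<^sub>2)" "coarser \<tau>\<^sub>2 (topology_join \<tau>\<^sub>1 \<tau>\<^sub>2)"
    by (auto simp: coarser_def topology_join_def intro: topology_generated_by_Basis)
  assume *: "coarser \<tau>\<^sub>1 \<sigma>" "coarser \<tau>\<^sub>2 \<sigma>"
  show "coarser (topology_join \<tau>\<^sub>1 \<tau>\<^sub>2) \<sigma>"
    using generate_topology_on_coarsest[OF istopology_openin[of \<sigma>],
        of "{U. openin \<tau>\<^sub>1 U} \<union> {U. openin \<tau>\<^sub>2 U}"] *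
    unfolding coarser_def topology_join_def openin_topology_generated_by_iff by auto
qed

lemma group_int_vec_group: "group (int_vec_group :: (int ^ 'n) monoid)"
proof (rule groupI)
  fix x :: "int ^ 'n"
  show "\<exists>y\<in>carrier int_vec_group. y \<otimes>\<^bsub>int_vec_group\<^esub> x = \<one>\<^bsub>int_vec_group\<^esub>"
    by (auto simp: int_vec_group_def intro: exI[of _ "- x"])
qed (auto simp: int_vec_group_def algebra_simps)

lemma locally_compact_group_discrete:
  assumes "group G"
  shows "locally_compact_group G (discrete_topology (carrier G))"
proof -
  interpret group G by fact
  have "locally_compact_space (discrete_topology (carrier G))"
    unfolding locally_compact_space_def
    by (metis compactin_sing empty_subsetI insert_subset openin_discrete_topology
        order_refl singletonI topspace_discrete_topology)
  then show ?thesis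
    using assms by (auto simp: locally_compact_group_def topological_group_def
        Hausdorff_space_discrete_topology prod_topology_discrete_topology[symmetric])
qed

lemma locally_compact_group_closed_subgroup:
  assumes H: "locally_compact_group H TH" and C: "subgroup C H" "closedin TH C"
  shows "locally_compact_group (H\<lparr>carrier := C\<rparr>) (subtopology TH C)"
proof -
  interpret group H
    using H by (simp add: locally_compact_group_def topological_group_def)
  have sp: "topspace TH = carrier H"
    and m: "continuous_map (prod_topology TH TH) TH (\<lambda>(x, y). x \<otimes>\<^bsub>H\<^esub> y)"
    and i: "continuous_map TH TH (\<lambda>x. inv\<^bsub>H\<^esub> x)"
    and hd: "Hausdorff_space TH" and lc: "locally_compact_space TH"
    using H by (auto simp: locally_compact_group_def topological_group_def)
  have CH: "C \<subseteq> carrier H" using C(1) by (rule subgroup.subset)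
  have "group (H\<lparr>carrier := C\<rparr>)"
    using C(1) by (rule subgroup.subgroup_is_group) (rule is_group)
  moreover have "topspace (subtopology TH C) = C"
    using CH sp by auto
  moreover have "continuous_map (prod_topology (subtopology TH C) (subtopology TH C))
      (subtopology TH C) (\<lambda>(x, y). x \<otimes>\<^bsub>H\<^esub> y)"
  proof -
    have "prod_topology (subtopology TH C) (subtopology TH C)
        = subtopology (prod_topology TH TH) (C \<times> C)"
      by (rule subtopology_Times[symmetric])
    then show ?thesis
      using C(1) CH sp continuous_map_from_subtopology[OF m, of "C \<times> C"]
      by (auto simp: continuous_map_in_subtopology subgroup.m_closed)
  qed
  moreover have "continuous_map (subtopology TH C) (subtopology TH C) (\<lambda>x. inv\<^bsub>H\<lparr>carrier := C\<rparr>\<^esub> x)"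
  proof (rule continuous_map_eq)
    show "continuous_map (subtopology TH C) (subtopology TH C) (\<lambda>x. inv\<^bsub>H\<^esub> x)"
      using C(1) CH sp continuous_map_from_subtopology[OF i, of C]
      by (auto simp: continuous_map_in_subtopology subgroup.m_inv_closed)
    fix x assume "x \<in> topspace (subtopology TH C)"
    then show "inv\<^bsub>H\<^esub> x = inv\<^bsub>H\<lparr>carrier := C\<rparr>\<^esub> x"
      using C(1) by (auto simp: m_inv_consistent)
  qed
  ultimately show ?thesis
    using Hausdorff_space_subtopology[OF hd] locally_compact_space_closed_subset[OF lc C(2)]
    by (simp add: locally_compact_group_def topological_group_def)
qed

lemma locally_compact_group_transport:
  fixes H :: "('b, 'k) monoid_scheme" and e :: "'b \<Rightarrow> 'c"
  assumes H: "locally_compact_group H TH" and e: "inj_on e (carrier H)"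
  obtains H' :: "'c monoid" and TH' where
    "locally_compact_group H' TH'" "e \<in> hom H H'" "homeomorphic_map TH TH' e"
proof -
  interpret group H
    using H by (simp add: locally_compact_group_def topological_group_def)
  have sp: "topspace TH = carrier H"
    and m: "continuous_map (prod_topology TH TH) TH (\<lambda>(x, y). x \<otimes>\<^bsub>H\<^esub> y)"
    and i: "continuous_map TH TH (\<lambda>x. inv\<^bsub>H\<^esub> x)"
    and hd: "Hausdorff_space TH" and lc: "locally_compact_space TH"
    using H by (auto simp: locally_compact_group_def topological_group_def)
  define g where "g = inv_into (carrier H) e"
  define D where "D = e ` carrier H"
  define H' :: "'c monoid"
    where "H' = \<lparr>carrier = D, monoid.mult = (\<lambda>a b. e (g a \<otimes>\<^bsub>H\<^esub> g b)), one = e \<one>\<^bsub>H\<^esub>\<rparr>"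
  define TH' where "TH' = pullback_topology D g TH"
  have ge: "g (e x) = x" if "x \<in> carrier H" for x
    using e that by (simp add: g_def)
  have gD: "g a \<in> carrier H" "e (g a) = a" if "a \<in> D" for a
    using that ge by (auto simp: D_def)
  have eD: "e x \<in> D" if "x \<in> carrier H" for x
    using that by (simp add: D_def)
  have sp': "topspace TH' = D"
    using gD by (auto simp: TH'_def topspace_pullback_topology sp)
  have cg: "continuous_map TH' TH g"
    using continuous_map_pullback[OF continuous_map_id, where A = D and f = g and ?T1.0 = TH]
    by (simp add: TH'_def)
  have ce: "continuous_map TH TH' e"
    unfolding TH'_def
  proof (rule continuous_map_pullback')
    show "continuous_map TH TH (g \<circ> e)"
      by (rule continuous_map_eq[OF continuous_map_id]) (auto simp: sp ge)
    show "topspace TH \<subseteq> e -` D"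
      using eD by (auto simp: sp)
  qed
  have hm: "homeomorphic_maps TH TH' e g"
    using ce cg by (auto simp: homeomorphic_maps_def sp sp' ge gD)
  then have hs: "TH homeomorphic_space TH'"
    by (auto simp: homeomorphic_space_def)
  have grp: "group H'"
  proof (rule groupI)
    fix a assume "a \<in> carrier H'"
    then have a: "a \<in> D" by (simp add: H'_def)
    show "\<exists>b\<in>carrier H'. b \<otimes>\<^bsub>H'\<^esub> a = \<one>\<^bsub>H'\<^esub>"
      by (rule bexI[of _ "e (inv\<^bsub>H\<^esub> (g a))"]) (auto simp: H'_def a eD ge gD l_inv)
  qed (auto simp: H'_def eD ge gD m_assoc)
  have inv': "inv\<^bsub>H'\<^esub> a = e (inv\<^bsub>H\<^esub> (g a))" if "a \<in> D" for a
    by (rule group.inv_equality[OF grp]) (auto simp: H'_def that eD ge gD l_inv)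
  have "continuous_map (prod_topology TH' TH') TH' (\<lambda>(x, y). x \<otimes>\<^bsub>H'\<^esub> y)"
  proof -
    have "continuous_map (prod_topology TH' TH') (prod_topology TH TH) (\<lambda>(x, y). (g x, g y))"
      using cg by (simp add: continuous_map_prod_top)
    from continuous_map_compose[OF continuous_map_compose[OF this m] ce]
    show ?thesis by (simp add: o_def case_prod_unfold H'_def)
  qed
  moreover have "continuous_map TH' TH' (\<lambda>x. inv\<^bsub>H'\<^esub> x)"
    by (rule continuous_map_eq[OF continuous_map_compose[OF continuous_map_compose[OF cg i] ce]])
      (simp add: sp' inv')
  moreover have "Hausdorff_space TH'" "locally_compact_space TH'"
    using hd lc homeomorphic_Hausdorff_space[OF hs] homeomorphic_locally_compact_space[OF hs]
    by auto
  ultimately have "locally_compact_group H' TH'"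
    using grp sp' by (simp add: locally_compact_group_def topological_group_def H'_def)
  moreover have "e \<in> hom H H'"
    by (auto simp: hom_def H'_def eD ge)
  moreover have "homeomorphic_map TH TH' e"
    using hm homeomorphic_maps_map by blast
  ultimately show thesis by (rule that)
qed

lemma subgroup_closure_of:
  assumes H: "locally_compact_group H TH" and A: "subgroup A H"
  shows "subgroup (TH closure_of A) H"
proof -
  interpret group H
    using H by (simp add: locally_compact_group_def topological_group_def)
  have sp: "topspace TH = carrier H"
    and m: "continuous_map (prod_topology TH TH) TH (\<lambda>(x, y). x \<otimes>\<^bsub>H\<^esub> y)"
    and i: "continuous_map TH TH (\<lambda>x. inv\<^bsub>H\<^esub> x)"
    using H by (auto simp: locally_compact_group_def topological_group_def)
  have AC: "A \<subseteq> TH closure_of A"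
    using subgroup.subset[OF A] by (simp add: closure_of_subset sp)
  show ?thesis
  proof (rule subgroupI)
    show "TH closure_of A \<subseteq> carrier H"
      using closure_of_subset_topspace[of TH A] by (simp add: sp)
    show "TH closure_of A \<noteq> {}"
      using AC subgroup.one_closed[OF A] by blast
    fix a assume a: "a \<in> TH closure_of A"
    have "(\<lambda>x. inv\<^bsub>H\<^esub> x) ` A \<subseteq> A"
      using A by (auto simp: subgroup.m_inv_closed)
    then show "inv\<^bsub>H\<^esub> a \<in> TH closure_of A"
      using continuous_map_image_closure_subset[OF i, of A] a closure_of_mono by blast
    fix b assume b: "b \<in> TH closure_of A"
    have "(\<lambda>(x, y). x \<otimes>\<^bsub>H\<^esub> y) ` (A \<times> A) \<subseteq> A"
      using A by (auto simp: subgroup.m_closed)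
    moreover have "(a, b) \<in> prod_topology TH TH closure_of (A \<times> A)"
      using a b by (simp add: closure_of_Times)
    ultimately show "a \<otimes>\<^bsub>H\<^esub> b \<in> TH closure_of A"
      using continuous_map_image_closure_subset[OF m, of "A \<times> A"]
        closure_of_mono[of "(\<lambda>(x, y). x \<otimes>\<^bsub>H\<^esub> y) ` (A \<times> A)" A TH] by blast
  qed
qed

lemma dense_pair_exists:
  fixes G :: "('a, 'm) monoid_scheme" and H :: "('b, 'k) monoid_scheme"
  assumes G: "topological_group G TG" and H: "locally_compact_group H TH"
    and \<eta>: "continuous_hom G TG H TH \<eta>"
  obtains H' :: "'a set set monoid" and TH' \<eta>' where
    "dense_pair G TG (pullback_topology (carrier G) \<eta> TH) H' TH' \<eta>'"
proof -
  have gG: "group G" and spG: "topspace TG = carrier G"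
    using G by (auto simp: topological_group_def)
  have gH: "group H" and sp: "topspace TH = carrier H" and hd: "Hausdorff_space TH"
    using H by (auto simp: locally_compact_group_def topological_group_def)
  have hom: "\<eta> \<in> hom G H" and cont: "continuous_map TG TH \<eta>"
    using \<eta> by (auto simp: continuous_hom_def)
  have im: "\<eta> ` carrier G \<subseteq> carrier H"
    using hom by (auto simp: hom_def)
  define C where "C = TH closure_of (\<eta> ` carrier G)"
  have imC: "\<eta> ` carrier G \<subseteq> C"
    unfolding C_def using im by (simp add: closure_of_subset sp)
  have "subgroup (\<eta> ` carrier G) H"
    using hom gG gH by (intro group_hom.img_is_subgroup) (simp add: group_hom_def group_hom_axioms_def)
  then have "subgroup C H"
    unfolding C_def by (rule subgroup_closure_of[OF H])
  then have lcC: "locally_compact_group (H\<lparr>carrier := C\<rparr>) (subtopology TH C)"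
    by (rule locally_compact_group_closed_subgroup[OF H]) (simp add: C_def)
  have CH: "C \<subseteq> carrier H"
    unfolding C_def using closure_of_subset_topspace[of TH] by (simp add: sp)
  define e where "e x = {\<eta> -` U \<inter> carrier G | U. openin TH U \<and> x \<in> U}" for x
  have sep: "e x \<noteq> e y" if x: "x \<in> C" and y: "y \<in> C" and ne: "x \<noteq> y" for x y
  proof
    assume eq: "e x = e y"
    have "x \<in> topspace TH" "y \<in> topspace TH"
      using x y CH sp by auto
    with ne obtain U V where UV: "openin TH U" "openin TH V" "x \<in> U" "y \<in> V" "U \<inter> V = {}"
      using hd unfolding Hausdorff_space_def disjnt_def by metis
    have "\<eta> -` U \<inter> carrier G \<in> e y"
      using UV eq[symmetric] by (auto simp: e_def)
    then obtain W where W: "openin TH W" "y \<in> W" "\<eta> -` U \<inter> carrier G = \<eta> -` W \<inter> carrier G"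
      by (auto simp: e_def)
    have "openin TH (V \<inter> W)" "y \<in> V \<inter> W"
      using UV W by auto
    then obtain s where "s \<in> carrier G" "\<eta> s \<in> V \<inter> W"
      using y unfolding C_def in_closure_of by blast
    then show False
      using W(3) UV(5) by blast
  qed
  have "inj_on e (carrier (H\<lparr>carrier := C\<rparr>))"
    using sep by (simp add: inj_on_def) blast
  then obtain H' :: "'a set set monoid" and TH' where H': "locally_compact_group H' TH'"
    and eh: "e \<in> hom (H\<lparr>carrier := C\<rparr>) H'" and em: "homeomorphic_map (subtopology TH C) TH' e"
    by (rule locally_compact_group_transport[OF lcC])
  have tC: "topspace (subtopology TH C) = C"
    using CH sp by auto
  have sp': "topspace TH' = carrier H'"
    using H' by (auto simp: locally_compact_group_def topological_group_def)
  have "continuous_map TG (subtopology TH C) \<eta>"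
    using cont imC spG by (auto simp: continuous_map_in_subtopology)
  then have "continuous_map TG TH' (e \<circ> \<eta>)"
    using homeomorphic_imp_continuous_map[OF em] by (rule continuous_map_compose)
  moreover have "e \<circ> \<eta> \<in> hom G H'"
    using hom eh imC by (auto simp: hom_def Pi_iff image_subset_iff)
  ultimately have ch: "continuous_hom G TG H' TH' (e \<circ> \<eta>)"
    by (simp add: continuous_hom_def)
  have eC: "e ` C = carrier H'"
    using homeomorphic_imp_surjective_map[OF em] tC sp' by simp
  have pb: "pullback_topology (carrier G) \<eta> TH = pullback_topology (carrier G) (e \<circ> \<eta>) TH'"
    (is "?L = ?R")
  proof -
    have "(\<exists>U. openin TH U \<and> S = \<eta> -` U \<inter> carrier G) \<longleftrightarrow>
          (\<exists>V. openin TH' V \<and> S = (e \<circ> \<eta>) -` V \<inter> carrier G)" for S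
    proof
      assume "\<exists>U. openin TH U \<and> S = \<eta> -` U \<inter> carrier G"
      then obtain U where U: "openin TH U" "S = \<eta> -` U \<inter> carrier G" by blast
      have "openin (subtopology TH C) (U \<inter> C)"
        using U(1) by (auto simp: openin_subtopology)
      then have "openin TH' (e ` (U \<inter> C))"
        using homeomorphic_imp_open_map[OF em] by (auto simp: open_map_def)
      moreover have "S = (e \<circ> \<eta>) -` (e ` (U \<inter> C)) \<inter> carrier G"
      proof -
        have "e (\<eta> s) \<in> e ` (U \<inter> C) \<longleftrightarrow> \<eta> s \<in> U" if "s \<in> carrier G" for s
        proof
          assume "e (\<eta> s) \<in> e ` (U \<inter> C)"
          then obtain x where "x \<in> U" "x \<in> C" "e (\<eta> s) = e x" by blast
          moreover have "\<eta> s \<in> C" using imC that by blast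
          ultimately show "\<eta> s \<in> U" using sep[of "\<eta> s" x] by blast
        next
          assume "\<eta> s \<in> U"
          then show "e (\<eta> s) \<in> e ` (U \<inter> C)" using imC that by blast
        qed
        then show ?thesis
          unfolding U(2) set_eq_iff by (simp add: vimage_def) blast
      qed
      ultimately show "\<exists>V. openin TH' V \<and> S = (e \<circ> \<eta>) -` V \<inter> carrier G" by blast
    next
      assume "\<exists>V. openin TH' V \<and> S = (e \<circ> \<eta>) -` V \<inter> carrier G"
      then obtain V where V: "openin TH' V" "S = (e \<circ> \<eta>) -` V \<inter> carrier G" by blast
      have "openin (subtopology TH C) {x \<in> C. e x \<in> V}"
        using openin_continuous_map_preimage[OF homeomorphic_imp_continuous_map[OF em] V(1)]
        unfolding tC .
      then obtain U where U: "openin TH U" "{x \<in> C. e x \<in> V} = U \<inter> C"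
        by (auto simp: openin_subtopology)
      have "e (\<eta> s) \<in> V \<longleftrightarrow> \<eta> s \<in> U" if "s \<in> carrier G" for s
      proof -
        have "\<eta> s \<in> C" using imC that by blast
        then show ?thesis using U(2) by blast
      qed
      then have "S = \<eta> -` U \<inter> carrier G"
        unfolding V(2) set_eq_iff by (simp add: vimage_def) blast
      with U(1) show "\<exists>U. openin TH U \<and> S = \<eta> -` U \<inter> carrier G" by blast
    qed
    then show ?thesis
      by (simp add: topology_eq openin_pullback_topology)
  qed
  have dense: "TH' closure_of ((e \<circ> \<eta>) ` carrier G) = carrier H'"
  proof -
    have "e ` (subtopology TH C closure_of (\<eta> ` carrier G)) = TH' closure_of (e ` \<eta> ` carrier G)"
      by (rule homeomorphic_map_closure_of[OF em, symmetric]) (use imC tC in blast)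
    moreover have "subtopology TH C closure_of (\<eta> ` carrier G) = C"
      using imC by (simp add: closure_of_subtopology C_def Int_absorb1)
    ultimately show ?thesis
      using eC by (simp add: image_comp)
  qed
  show thesis
    by (rule that[of H' TH' "e \<circ> \<eta>"]) (use H' ch dense pb in \<open>simp only: dense_pair_def simp_thms\<close>)
qed

theorem lc_topologies_universal:
  fixes G :: "('a, 'm) monoid_scheme" and H :: "('b, 'k) monoid_scheme"
  assumes "topological_group G TG" "locally_compact_group H TH" "continuous_hom G TG H TH \<eta>"
  shows "pullback_topology (carrier G) \<eta> TH \<in> lc_topologies G TG"
  by (rule dense_pair_exists[OF assms]) (auto simp: dense_pair_def lc_topologies_def)

theorem lc_topologies_iff_dense_pair:
  fixes G :: "('a, 'm) monoid_scheme"
  assumes "topological_group G TG"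
  shows "\<tau> \<in> lc_topologies G TG \<longleftrightarrow>
    (\<exists>(H :: 'a set set monoid) TH \<eta>. dense_pair G TG \<tau> H TH \<eta>)"
proof
  assume "\<tau> \<in> lc_topologies G TG"
  then show "\<exists>(H :: 'a set set monoid) TH \<eta>. dense_pair G TG \<tau> H TH \<eta>"
    unfolding lc_topologies_def using dense_pair_exists[OF assms] by blast
qed (auto simp: dense_pair_def lc_topologies_def)

end

theory Submission
  imports Defs
begin

text \<open>To a subspace \<open>L\<close> of \<open>\<real>\<^sup>n\<close> we associate the topology induced on \<open>\<int>\<^sup>n\<close> by the map
  \<open>m \<mapsto> (P\<^sub>L m, (\<chi>(m))\<^sub>\<chi>)\<close> into \<open>\<real>\<^sup>n\<close> times a product of circles, where \<open>P\<^sub>L\<close> is the orthogonal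
  projection onto \<open>L\<close> and \<open>\<chi>\<close> ranges over all characters. Conversely a topology \<open>\<tau>\<close> determines the
  space of all \<open>l\<close> such that \<open>m \<mapsto> m \<bullet> l\<close> is bounded on some \<open>\<tau>\<close>-neighbourhood of \<open>0\<close>. Duality theory is
  avoided as follows. A precompact neighbourhood \<open>A\<close> of \<open>0\<close> is an approximate subgroup of \<open>\<real>\<^sup>n\<close>, hence at
  bounded distance from the orthogonal complement of its space \<open>L\<close> of bounded functionals. So \<open>A + \<Lambda>\<close>
  is syndetic for a subgroup \<open>\<Lambda>\<close> that \<open>P\<^sub>L\<close> maps onto a lattice of \<open>L\<close>, and Bogolyubov's theorem (by
  Fourier analysis on boxes and compactness) provides enough characters to show that \<open>\<tau>\<close> is coarser than the topology of
  \<open>L\<close>; \<open>\<tau>\<close> is then a quotient of it.\<close>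

section \<open>Bogolyubov's theorem on syndetic sets\<close>

text \<open>A proper connecting map has compact kernel, and a compact group has no nonzero
  homomorphism to the reals; this is why the space of bounded functionals is constant along
  quotients. Among the topologies with a given space \<open>L\<close> there is a finest one:
  circle-valued characters cost only a compact factor, so all of them are adjoined at once. A
  topology that is not a non-trivial quotient must be this finest one. The hard point is that
  nothing finer can occur, i.e. that every \<open>\<tau>\<close>-neighbourhood of \<open>0\<close>
  contains a Bohr neighbourhood. Bogolyubov's theorem yields Bohr neighbourhoods, but only from
  syndetic sets, and a precompact set has bounded projection to \<open>L\<close>, so it is not
  syndetic unless \<open>L\<close> is \<open>0\<close>. The projection of all integer points to
  \<open>L\<close> is in general not discrete, so the missing directions cannot be filled with
  everything; a subgroup that projects injectively onto a lattice is used, because then a small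
  projection forces its contribution to vanish exactly.\<close>

definition rvec :: "int ^ 'n \<Rightarrow> real ^ 'n" where
  "rvec m = (\<chi> i. real_of_int (m $ i))"

lemma rvec_nth [simp]: "rvec m $ i = real_of_int (m $ i)"
  by (simp add: rvec_def)

lemma rvec_0 [simp]: "rvec 0 = 0"
  and rvec_add: "rvec (a + b) = rvec a + rvec b"
  and rvec_diff: "rvec (a - b) = rvec a - rvec b"
  and rvec_minus: "rvec (- a) = - rvec a"
  by (simp_all add: vec_eq_iff)

lemma rvec_sum: "rvec (\<Sum>x\<in>A. f x) = (\<Sum>x\<in>A. rvec (f x))"
  by (induction A rule: infinite_finite_induct) (simp_all add: rvec_add)

lemma finite_int_vec_bounded: "finite {m :: int ^ 'n. \<forall>i. \<bar>m $ i\<bar> \<le> K}"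
proof (rule finite_subset)
  show "{m :: int ^ 'n. \<forall>i. \<bar>m $ i\<bar> \<le> K} \<subseteq> vec_lambda ` (UNIV \<rightarrow>\<^sub>E {-K..K})"
  proof
    fix m :: "int ^ 'n" assume "m \<in> {m. \<forall>i. \<bar>m $ i\<bar> \<le> K}"
    then have "vec_nth m \<in> UNIV \<rightarrow>\<^sub>E {-K..K}" by (auto simp: abs_le_iff) (metis minus_le_iff)
    then show "m \<in> vec_lambda ` (UNIV \<rightarrow>\<^sub>E {-K..K})"
      by (metis image_eqI vec_nth_inverse)
  qed
qed (auto intro!: finite_imageI finite_PiE)

lemma finite_rvec_bounded: "finite {m :: int ^ 'n. norm (rvec m) \<le> R}"
proof (rule finite_subset[OF _ finite_int_vec_bounded[of "\<lfloor>R\<rfloor>"]])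
  show "{m :: int ^ 'n. norm (rvec m) \<le> R} \<subseteq> {m. \<forall>i. \<bar>m $ i\<bar> \<le> \<lfloor>R\<rfloor>}"
  proof safe
    fix m :: "int ^ 'n" and i assume "norm (rvec m) \<le> R"
    then have "real_of_int \<bar>m $ i\<bar> \<le> R"
      using component_le_norm_cart[of "rvec m" i] by simp
    then show "\<bar>m $ i\<bar> \<le> \<lfloor>R\<rfloor>" by (simp add: le_floor_iff)
  qed
qed

text \<open>Every homomorphism to the circle has this form. \<open>\<theta>\<close> matters only
  modulo integer vectors; indexing by all real vectors repeats characters but avoids a quotient
  type.\<close>

definition character :: "real ^ 'n \<Rightarrow> int ^ 'n \<Rightarrow> complex" where
  "character \<theta> m = cis (2 * pi * (\<theta> \<bullet> rvec m))"

lemma character_0 [simp]: "character \<theta> 0 = 1"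
  and character_0_left [simp]: "character 0 m = 1"
  and character_add: "character \<theta> (a + b) = character \<theta> a * character \<theta> b"
  and character_diff: "character \<theta> (a - b) = character \<theta> a * cnj (character \<theta> b)"
  and norm_character [simp]: "norm (character \<theta> m) = 1"
  by (simp_all add: character_def rvec_add rvec_diff inner_add_right inner_diff_right ring_distribs
      cis_mult cis_cnj)

lemma Re_character: "Re (character \<theta> m) = cos (2 * pi * (\<theta> \<bullet> rvec m))"
  by (simp add: character_def)

section \<open>Fourier analysis modulo \<open>M\<close>\<close>

definition box_freq :: "nat \<Rightarrow> ('n \<Rightarrow> nat) set" where
  "box_freq M = (UNIV \<rightarrow>\<^sub>E {..<M})"

text \<open>For \<open>k\<close> in \<open>box_freq M\<close> these are the \<open>M\<close>-torsion
  points of the torus, that is, the characters of the integer vectors modulo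
  \<open>M\<close>.\<close>

definition freq :: "nat \<Rightarrow> ('n \<Rightarrow> nat) \<Rightarrow> real ^ 'n" where
  "freq M k = (\<chi> i. real (k i) / real M)"

lemma finite_box_freq [simp]: "finite (box_freq M :: ('n::finite \<Rightarrow> nat) set)"
  by (auto simp: box_freq_def intro: finite_PiE)

lemma card_box_freq: "card (box_freq M :: ('n::finite \<Rightarrow> nat) set) = M ^ CARD('n)"
  by (simp add: box_freq_def card_PiE)

lemma cis_sum: "cis (\<Sum>x\<in>A. f x) = (\<Prod>x\<in>A. cis (f x))"
  by (induction A rule: infinite_finite_induct) (simp_all flip: cis_mult)

text \<open>The summands are the powers of an \<open>M\<close>-th root of unity, and the assumption
  on \<open>x\<close> says that this root is not \<open>1\<close>, so the geometric sum
  vanishes.\<close>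

lemma cis_root_sum_0:
  assumes "0 < M" and x: "\<not> int M dvd x"
  shows "(\<Sum>j<M. cis (2 * pi * (real j / real M * real_of_int x))) = 0"
proof -
  define w where "w = cis (2 * pi * (real_of_int x / real M))"
  have ne: "w \<noteq> 1"
  proof
    assume "w = 1"
    then have "cos (2 * pi * (real_of_int x / real M)) = 1"
      by (simp add: w_def complex_eq_iff)
    then obtain k :: int where "2 * pi * (real_of_int x / real M) = of_int k * 2 * pi"
      by (auto simp: cos_one_2pi_int)
    then have "real_of_int x = of_int k * real M"
      using assms(1) by (simp add: field_simps)
    then have "x = k * int M" by (metis of_int_eq_iff of_int_mult of_int_of_nat_eq)
    with x show False by simp
  qed
  have "w ^ M = 1"
    using assms(1) by (simp add: w_def Complex.DeMoivre cis_multiple_2pi)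
  moreover have "cis (2 * pi * (real j / real M * real_of_int x)) = w ^ j" for j
    by (simp add: w_def Complex.DeMoivre field_simps)
  ultimately show ?thesis
    using ne by (simp add: geometric_sum)
qed

text \<open>The sum over the box factors over the coordinates, and the factor at \<open>i\<close> is
  a vanishing sum of roots of unity.\<close>

lemma sum_character_freq_eq_0:
  fixes x :: "int ^ 'n"
  assumes "0 < M" and "\<not> int M dvd x $ i"
  shows "(\<Sum>k\<in>box_freq M. character (freq M k) x) = 0"
proof -
  have "character (freq M k) x = (\<Prod>i\<in>UNIV. cis (2 * pi * (real (k i) / real M * real_of_int (x $ i))))"
    for k
    by (simp add: character_def freq_def inner_vec_def sum_distrib_left cis_sum)
  then have "(\<Sum>k\<in>box_freq M. character (freq M k) x) =
      (\<Prod>i\<in>UNIV. \<Sum>j<M. cis (2 * pi * (real j / real M * real_of_int (x $ i))))"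
    unfolding box_freq_def by (subst prod_sum_PiE) auto
  also have "\<dots> = 0"
    using cis_root_sum_0[OF assms] by (auto simp: prod_zero_iff)
  finally show ?thesis .
qed

text \<open>Expanding the powers of \<open>F\<close> and summing over the frequencies first leaves
  complete character sums, which vanish unless \<open>M\<close> divides every coordinate of the
  argument. \<open>4 * N \<le> M\<close> excludes wrap-around: the coordinates of
  \<open>a + b - c - d - m\<close> are below \<open>3 * N\<close> in absolute value, so divisibility
  by \<open>M\<close> means being \<open>0\<close>. The first part is Parseval's identity; in the
  second, the fourth powers detect the representations of \<open>m\<close>.\<close>

lemma character_freq_sums:
  fixes A :: "(int ^ 'n) set"
  defines "F \<equiv> \<lambda>M k. \<Sum>a\<in>A. character (freq M k) a"
  assumes "finite A" and M: "0 < M"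
    and A: "\<And>a i. a \<in> A \<Longrightarrow> 0 \<le> a $ i \<and> a $ i < int N" and N: "4 * N \<le> M"
  shows "(\<Sum>k\<in>box_freq M. (norm (F M k))\<^sup>2) = real M ^ CARD('n) * real (card A)"
    and "\<lbrakk>\<And>i. \<bar>m $ i\<bar> < int N; \<not> (\<exists>a\<in>A. \<exists>b\<in>A. \<exists>c\<in>A. \<exists>d\<in>A. m = a + b - c - d)\<rbrakk> \<Longrightarrow>
      (\<Sum>k\<in>box_freq M. (norm (F M k)) ^ 4 * Re (character (freq M k) m)) = 0"
proof -
  have nn: "of_real ((norm (F M k))\<^sup>2) = (\<Sum>a\<in>A. \<Sum>b\<in>A. character (freq M k) (a - b))" for k
    by (simp only: complex_norm_square F_def character_diff cnj_sum sum_product)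
  have "of_real (\<Sum>k\<in>box_freq M. (norm (F M k))\<^sup>2)
      = (\<Sum>a\<in>A. \<Sum>b\<in>A. \<Sum>k\<in>box_freq M. character (freq M k) (a - b))"
    unfolding of_real_sum nn
    by (subst sum.swap, rule sum.cong[OF refl], rule sum.swap)
  also have "\<dots> = (\<Sum>a\<in>A. \<Sum>b\<in>A. if b = a then of_nat (M ^ CARD('n)) else 0)"
  proof (intro sum.cong refl)
    fix a b assume ab: "a \<in> A" "b \<in> A"
    show "(\<Sum>k\<in>box_freq M. character (freq M k) (a - b)) =
      (if b = a then of_nat (M ^ CARD('n)) else (0::complex))"
    proof (cases "b = a")
      case False
      then obtain i where i: "b $ i \<noteq> a $ i" by (auto simp: vec_eq_iff)
      have "\<not> int M dvd (a - b) $ i"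
        using i zdvd_imp_le[of "int M" "\<bar>a $ i - b $ i\<bar>"] A[OF ab(1), of i] A[OF ab(2), of i] N by auto
      from sum_character_freq_eq_0[OF M this] show ?thesis using False by simp
    qed (simp add: card_box_freq)
  qed
  also have "\<dots> = of_real (real M ^ CARD('n) * real (card A))"
    using \<open>finite A\<close> by simp
  finally show "(\<Sum>k\<in>box_freq M. (norm (F M k))\<^sup>2) = real M ^ CARD('n) * real (card A)"
    by (simp only: of_real_eq_iff)
  assume m: "\<And>i. \<bar>m $ i\<bar> < int N" and no: "\<not> (\<exists>a\<in>A. \<exists>b\<in>A. \<exists>c\<in>A. \<exists>d\<in>A. m = a + b - c - d)"
  have "of_real (norm (F M k) ^ 4) * character (freq M k) (- m)
      = (\<Sum>a\<in>A. \<Sum>c\<in>A. \<Sum>b\<in>A. \<Sum>d\<in>A. character (freq M k) (a + b - c - d - m))" for k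
  proof -
    have "of_real (norm (F M k) ^ 4) = (of_real ((norm (F M k))\<^sup>2) :: complex)\<^sup>2"
      by simp
    also have "\<dots> = (\<Sum>a\<in>A. \<Sum>c\<in>A. character (freq M k) (a - c))\<^sup>2"
      by (simp only: nn)
    also have "\<dots> = (\<Sum>a\<in>A. \<Sum>c\<in>A. \<Sum>b\<in>A. \<Sum>d\<in>A. character (freq M k) (a - c) * character (freq M k) (b - d))"
      unfolding power2_eq_square by (simp only: sum_distrib_right) (simp only: sum_distrib_left)
    finally have eq: "of_real (norm (F M k) ^ 4) = \<dots>" .
    have "character (freq M k) (a - c) * character (freq M k) (b - d) * character (freq M k) (- m)
        = character (freq M k) (a + b - c - d - m)" for a b c d
      by (simp flip: character_add) (simp add: algebra_simps)
    then show ?thesis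
      by (simp only: eq sum_distrib_right)
  qed
  then have "(\<Sum>k\<in>box_freq M. of_real (norm (F M k) ^ 4) * character (freq M k) (- m)) =
      (\<Sum>a\<in>A. \<Sum>c\<in>A. \<Sum>b\<in>A. \<Sum>d\<in>A. \<Sum>k\<in>box_freq M. character (freq M k) (a + b - c - d - m))"
    by (simp add: sum.swap[of _ _ "box_freq M"])
  also have "\<dots> = 0"
  proof -
    have "(\<Sum>k\<in>box_freq M. character (freq M k) (a + b - c - d - m)) = 0"
      if abcd: "a \<in> A" "b \<in> A" "c \<in> A" "d \<in> A" for a b c d
    proof -
      from abcd no obtain i where i: "(a + b - c - d) $ i \<noteq> m $ i" by (metis vec_eq_iff)
      have "\<not> int M dvd (a + b - c - d - m) $ i"
        using i zdvd_imp_le[of "int M" "\<bar>(a + b - c - d - m) $ i\<bar>"] m[of i]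
          A[OF abcd(1), of i] A[OF abcd(2), of i] A[OF abcd(3), of i] A[OF abcd(4), of i] N by auto
      from sum_character_freq_eq_0[OF M this] show ?thesis .
    qed
    then show ?thesis by simp
  qed
  finally have "Re (\<Sum>k\<in>box_freq M. of_real (norm (F M k) ^ 4) * character (freq M k) (- m)) = 0"
    by simp
  \<comment> \<open>Cosine is even, so the real part does not see the sign of
    \<open>m\<close>.\<close>
  then show "(\<Sum>k\<in>box_freq M. (norm (F M k)) ^ 4 * Re (character (freq M k) m)) = 0"
    by (simp add: Re_character rvec_minus Re_sum del: of_real_power)
qed

text \<open>Bogolyubov's argument: the frequencies with a large Fourier coefficient are few by Parseval,
  and the others contribute less than the trivial frequency to \<open>1\<^sub>A * 1\<^sub>A * 1\<^sub>-\<^sub>A * 1\<^sub>-\<^sub>A\<close>.\<close>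

lemma bogolyubov_box:
  fixes A :: "(int ^ 'n) set"
  assumes fin: "finite A" and M: "0 < M" and A: "\<And>a i. a \<in> A \<Longrightarrow> 0 \<le> a $ i \<and> a $ i < int N"
    and N: "4 * N \<le> M" and \<delta>: "0 < \<delta>" "\<delta> * real M ^ CARD('n) \<le> real (card A)"
  obtains S where "finite S" "S \<subseteq> cbox 0 1" "real (card S) \<le> 2 / \<delta>\<^sup>2"
    "\<And>m. \<lbrakk>\<And>i. \<bar>m $ i\<bar> < int N; \<And>\<theta>. \<theta> \<in> S \<Longrightarrow> 0 \<le> Re (character \<theta> m)\<rbrakk> \<Longrightarrow>
      \<exists>a\<in>A. \<exists>b\<in>A. \<exists>c\<in>A. \<exists>d\<in>A. m = a + b - c - d"
proof -
  define F where "F k = (\<Sum>a\<in>A. character (freq M k) a)" for k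
  define P where "P = real M ^ CARD('n)"
  define C where "C = real (card A)"
  \<comment> \<open>With this threshold the coefficients below it contribute at most
    \<open>c * (P * C) \<le> C ^ 4 / 2\<close>, half of the contribution \<open>C ^ 4\<close> of the
    trivial frequency.\<close>
  define c where "c = \<delta> * C\<^sup>2 / 2"
  define K where "K = {k \<in> box_freq M. (norm (F k))\<^sup>2 \<ge> c}"
  have P: "0 < P" using M by (simp add: P_def)
  have \<delta>P: "\<delta> * P \<le> C" using \<delta>(2) by (simp add: P_def C_def)
  have C: "0 < C" using mult_pos_pos[OF \<delta>(1) P] \<delta>P by linarith
  have c: "0 < c" using C \<delta>(1) by (simp add: c_def)
  have parseval: "(\<Sum>k\<in>box_freq M. (norm (F k))\<^sup>2) = P * C"
    unfolding F_def P_def C_def by (rule character_freq_sums(1)[OF fin M A N])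
  have finK: "finite K" by (simp add: K_def)
  \<comment> \<open>Parseval limits the number of large coefficients. The resulting bound
    \<open>2 / \<delta>\<^sup>2\<close> does not depend on \<open>M\<close>, which the limit over
    growing boxes requires.\<close>
  have "real (card K) * c \<le> (\<Sum>k\<in>K. (norm (F k))\<^sup>2)"
    using sum_bounded_below[of K c "\<lambda>k. (norm (F k))\<^sup>2"] by (simp add: K_def)
  also have "\<dots> \<le> P * C"
    unfolding parseval[symmetric] by (rule sum_mono2) (auto simp: K_def)
  finally have "real (card K) * \<delta> * C \<le> 2 * P"
    using C by (simp add: c_def power2_eq_square field_simps)
  then have "real (card K) * \<delta> * (\<delta> * P) \<le> 2 * P"
    using mult_left_mono[OF \<delta>P, of "real (card K) * \<delta>"] \<delta>(1) by (simp add: order_trans)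
  then have cardK: "real (card K) \<le> 2 / \<delta>\<^sup>2"
    using P \<delta>(1) by (simp add: field_simps power2_eq_square)
  show thesis
  proof (rule that)
    show "finite (freq M ` K)" using finK by simp
    show "freq M ` K \<subseteq> cbox 0 1"
      using M by (auto simp: K_def box_freq_def freq_def mem_box_cart PiE_iff field_simps less_imp_le)
    show "real (card (freq M ` K)) \<le> 2 / \<delta>\<^sup>2"
      using card_image_le[OF finK, of "freq M"] cardK by (meson of_nat_mono order_trans)
    fix m :: "int ^ 'n"
    assume m: "\<And>i. \<bar>m $ i\<bar> < int N" and pos: "\<And>\<theta>. \<theta> \<in> freq M ` K \<Longrightarrow> 0 \<le> Re (character \<theta> m)"
    show "\<exists>a\<in>A. \<exists>b\<in>A. \<exists>c\<in>A. \<exists>d\<in>A. m = a + b - c - d"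
    proof (rule ccontr)
      assume no: "\<not> ?thesis"
      define z :: "'n \<Rightarrow> nat" where "z = (\<lambda>_. 0)"
      have z: "z \<in> box_freq M" using M by (auto simp: z_def box_freq_def)
      have fz: "freq M z = 0" by (simp add: freq_def z_def vec_eq_iff)
      have Fz: "norm (F z) = C" by (simp add: F_def fz C_def)
      \<comment> \<open>Large frequencies contribute non-negatively by the choice of
        \<open>m\<close>; for the others, one factor \<open>(norm (F k))\<^sup>2\<close> is at most
        \<open>c\<close> and the real part is at least \<open>- 1\<close>.\<close>
      have lower: "norm (F k) ^ 4 * Re (character (freq M k) m) \<ge> - c * (norm (F k))\<^sup>2"
        if "k \<in> box_freq M" for k
      proof (cases "k \<in> K")
        case True
        then have "0 \<le> norm (F k) ^ 4 * Re (character (freq M k) m)" using pos by simp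
        moreover have "- c * (norm (F k))\<^sup>2 \<le> 0" using c by simp
        ultimately show ?thesis by linarith
      next
        case False
        then have "(norm (F k))\<^sup>2 \<le> c" using that by (simp add: K_def)
        then have "norm (F k) ^ 4 \<le> c * (norm (F k))\<^sup>2"
          using mult_right_mono[of "(norm (F k))\<^sup>2" c "(norm (F k))\<^sup>2"]
          by (simp add: power4_eq_xxxx power2_eq_square algebra_simps)
        moreover have "- 1 \<le> Re (character (freq M k) m)" by (simp add: Re_character)
        then have "norm (F k) ^ 4 * Re (character (freq M k) m) \<ge> norm (F k) ^ 4 * (-1)"
          by (rule mult_left_mono) simp
        ultimately show ?thesis by linarith
      qed
      have "0 = (\<Sum>k\<in>box_freq M. (norm (F k)) ^ 4 * Re (character (freq M k) m))"
        unfolding F_def by (rule character_freq_sums(2)[OF fin M A N m no, symmetric])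
      also have "\<dots> = C ^ 4 + (\<Sum>k\<in>box_freq M - {z}. (norm (F k)) ^ 4 * Re (character (freq M k) m))"
        using z by (simp add: sum.remove fz Fz)
      also have "\<dots> \<ge> C ^ 4 + (\<Sum>k\<in>box_freq M - {z}. - c * (norm (F k))\<^sup>2)"
        by (intro add_left_mono sum_mono lower) auto
      moreover have "(\<Sum>k\<in>box_freq M - {z}. - c * (norm (F k))\<^sup>2) \<ge> (\<Sum>k\<in>box_freq M. - c * (norm (F k))\<^sup>2)"
        using c by (simp add: sum_negf sum_mono2)
      moreover have "(\<Sum>k\<in>box_freq M. - c * (norm (F k))\<^sup>2) = - c * (P * C)"
        by (simp add: sum_negf parseval flip: sum_distrib_left)
      moreover have "c * (P * C) \<le> C ^ 4 / 2"
        using mult_right_mono[OF \<delta>P, of "C ^ 3"] C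
        by (simp add: c_def power4_eq_xxxx power3_eq_cube power2_eq_square algebra_simps)
      moreover have "0 < C ^ 4" using C by simp
      ultimately show False by linarith
    qed
  qed
qed


section \<open>From boxes to all integer vectors\<close>

lemma card_int_box: "card {m :: int ^ 'n. \<forall>i. a \<le> m $ i \<and> m $ i < b} = nat (b - a) ^ CARD('n)"
proof -
  have "bij_betw vec_lambda (UNIV \<rightarrow>\<^sub>E {a..<b}) {m :: int ^ 'n. \<forall>i. a \<le> m $ i \<and> m $ i < b}"
    by (rule bij_betw_byWitness[where f' = vec_nth]) auto
  from bij_betw_same_card[OF this] show ?thesis by (simp add: card_PiE)
qed

text \<open>Induction on \<open>k\<close>: compactness refines the subsequence once for each index,
  and limits found earlier persist under refinement.\<close>

lemma common_convergent_subsequence: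
  fixes \<theta> :: "nat \<Rightarrow> nat \<Rightarrow> 'a :: metric_space"
  assumes "compact K" and \<theta>: "\<And>j i. \<theta> j i \<in> K"
  obtains r l where "strict_mono r" "\<And>i. i < k \<Longrightarrow> (\<lambda>j. \<theta> (r j) i) \<longlonglongrightarrow> l i"
proof -
  have "\<exists>r. strict_mono r \<and> (\<forall>i<k. \<exists>l. (\<lambda>j. \<theta> (r j) i) \<longlonglongrightarrow> l)"
  proof (induction k)
    case 0
    show ?case by (auto intro: exI[of _ id] strict_mono_id)
  next
    case (Suc k)
    then obtain r where r: "strict_mono r" "\<forall>i<k. \<exists>l. (\<lambda>j. \<theta> (r j) i) \<longlonglongrightarrow> l" by blast
    obtain l s where s: "strict_mono s" "((\<lambda>j. \<theta> (r j) k) \<circ> s) \<longlonglongrightarrow> l"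
      using \<open>compact K\<close> \<theta> unfolding compact_def by metis
    have "\<exists>l. (\<lambda>j. \<theta> ((r \<circ> s) j) i) \<longlonglongrightarrow> l" if "i < Suc k" for i
    proof (cases "i = k")
      case True
      then show ?thesis using s(2) by (auto simp: o_def)
    next
      case False
      with that r(2) obtain l' where "(\<lambda>j. \<theta> (r j) i) \<longlonglongrightarrow> l'" by (metis less_SucE)
      from LIMSEQ_subseq_LIMSEQ[OF this s(1)] show ?thesis by (auto simp: o_def)
    qed
    then show ?case using strict_mono_o[OF r(1) s(1)] by blast
  qed
  then show thesis using that by metis
qed

text \<open>Finitely many translates of \<open>A\<close> cover everything, so \<open>A\<close> has
  density at least \<open>\<delta>\<close> in every large box, and each box yields at most
  \<open>k\<close> frequencies in the unit cube with \<open>k\<close> fixed. Limits of these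
  frequencies work for all \<open>m\<close>: the strict inequality \<open>0 < Re\<close> at the
  limit passes to the approximating frequencies eventually, when the box also contains
  \<open>m\<close>.\<close>

theorem bogolyubov:
  fixes A :: "(int ^ 'n) set"
  assumes T: "finite T" and cover: "\<And>m. \<exists>t\<in>T. m - t \<in> A"
  obtains \<Theta> where "finite \<Theta>"
    "\<And>m. (\<And>\<theta>. \<theta> \<in> \<Theta> \<Longrightarrow> 0 < Re (character \<theta> m)) \<Longrightarrow>
      \<exists>a\<in>A. \<exists>b\<in>A. \<exists>c\<in>A. \<exists>d\<in>A. m = a + b - c - d"
proof -
  have "T \<noteq> {}" using cover by blast
  then have cT: "0 < card T" using T by (simp add: card_gt_0_iff)
  have "finite ((\<lambda>(t, i). nat \<bar>t $ i\<bar>) ` (T \<times> (UNIV :: 'n set)))"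
    using T by simp
  then obtain c where "\<forall>x\<in>(\<lambda>(t, i). nat \<bar>t $ i\<bar>) ` (T \<times> (UNIV :: 'n set)). x \<le> c"
    using finite_nat_set_iff_bounded_le by auto
  then have c: "\<bar>t $ i\<bar> \<le> int c" if "t \<in> T" for t i using that by (simp add: nat_le_iff)
  \<comment> \<open>The base \<open>8\<close> is the quotient of the modulus \<open>4 * N j\<close>
    by \<open>N j / 2\<close>. The latter bounds the side \<open>N j - 2 * c\<close> of the inner
    box \<open>Q\<close> from below, since \<open>N j\<close> exceeds \<open>4 * c\<close>.\<close>
  define \<delta> where "\<delta> = 1 / (8 ^ CARD('n) * real (card T))"
  have \<delta>: "0 < \<delta>" using cT by (simp add: \<delta>_def)
  define N where "N j = 4 * c + 1 + j" for j
  define B where "B j = {a \<in> A. \<forall>i. 0 \<le> a $ i \<and> a $ i < int (N j)}" for j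
  have finB: "finite (B j)" for j
    by (rule finite_subset[OF _ finite_int_vec_bounded[of "int (N j)"]])
      (auto simp: B_def abs_le_iff intro: order_trans[of _ 0] less_imp_le)
  have dens: "\<delta> * real (4 * N j) ^ CARD('n) \<le> real (card (B j))" for j
  proof -
    \<comment> \<open>The margin \<open>c\<close> on both sides keeps \<open>m - t\<close> inside
      the box for all \<open>t\<close> in \<open>T\<close>.\<close>
    define Q where "Q = {m :: int ^ 'n. \<forall>i. int c \<le> m $ i \<and> m $ i < int (N j) - int c}"
    have "Q \<subseteq> (\<Union>t\<in>T. (+) t ` B j)"
    proof
      fix m assume m: "m \<in> Q"
      obtain t where t: "t \<in> T" "m - t \<in> A" using cover by blast
      have "0 \<le> (m - t) $ i \<and> (m - t) $ i < int (N j)" for i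
        using m c[OF t(1), of i] by (auto simp: Q_def) (smt (verit))+
      then have "m - t \<in> B j" using t(2) by (simp add: B_def)
      then have "m \<in> (+) t ` B j" by (metis add.commute diff_add_cancel image_eqI)
      then show "m \<in> (\<Union>t\<in>T. (+) t ` B j)" using t(1) by blast
    qed
    then have "card Q \<le> card (\<Union>t\<in>T. (+) t ` B j)"
      using T finB by (intro card_mono) auto
    also have "\<dots> \<le> (\<Sum>t\<in>T. card ((+) t ` B j))" by (rule card_UN_le[OF T])
    also have "\<dots> = card T * card (B j)" by (simp add: card_image)
    finally have "real (card Q) \<le> real (card T) * real (card (B j))"
      by (metis of_nat_mono of_nat_mult)
    moreover have "int (N j) - int c - int c = int (N j - 2 * c)" "2 * c \<le> N j"
      by (auto simp: N_def of_nat_diff)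
    then have "real (card Q) = (real (N j) - 2 * real c) ^ CARD('n)"
      by (simp add: Q_def card_int_box of_nat_diff)
    moreover have "(real (N j) / 2) ^ CARD('n) \<le> (real (N j) - 2 * real c) ^ CARD('n)"
      by (rule power_mono) (auto simp: N_def)
    ultimately have le: "(real (N j) / 2) ^ CARD('n) \<le> real (card T) * real (card (B j))" by linarith
    have eq: "\<delta> * real (4 * N j) ^ CARD('n) = (real (N j) / 2) ^ CARD('n) / real (card T)"
      using power_mult_distrib[of 8 "real (N j) / 2" "CARD('n)"] by (simp add: \<delta>_def)
    show ?thesis unfolding eq using le cT by (simp add: pos_divide_le_eq mult.commute)
  qed
  define k where "k = nat \<lceil>2 / \<delta>\<^sup>2\<rceil>"
  have "\<exists>\<theta> :: nat \<Rightarrow> real ^ 'n. range \<theta> \<subseteq> cbox 0 1 \<and>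
     (\<forall>m. (\<forall>i. \<bar>m $ i\<bar> < int (N j)) \<longrightarrow> (\<forall>i<k. 0 \<le> Re (character (\<theta> i) m)) \<longrightarrow>
      (\<exists>a\<in>A. \<exists>b\<in>A. \<exists>c\<in>A. \<exists>d\<in>A. m = a + b - c - d))" for j
  proof -
    obtain S where S: "finite S" "S \<subseteq> cbox 0 1" "real (card S) \<le> 2 / \<delta>\<^sup>2"
      "\<And>m. \<lbrakk>\<And>i. \<bar>m $ i\<bar> < int (N j); \<And>\<theta>. \<theta> \<in> S \<Longrightarrow> 0 \<le> Re (character \<theta> m)\<rbrakk> \<Longrightarrow>
      \<exists>a\<in>B j. \<exists>b\<in>B j. \<exists>c\<in>B j. \<exists>d\<in>B j. m = a + b - c - d"
      by (rule bogolyubov_box[of "B j" "4 * N j" "N j" \<delta>])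
        (use finB \<delta> dens in \<open>auto simp: B_def N_def\<close>)
    have k: "card S \<le> k" using S(3) by (simp add: k_def le_nat_iff le_ceiling_iff)
    obtain f where f: "bij_betw f {..<card S} S"
      using ex_bij_betw_nat_finite[OF S(1)] by (auto simp: atLeast0LessThan)
    \<comment> \<open>Padding with \<open>0\<close>, a point of the cube whose character is
      constantly \<open>1\<close>, gives all families the common length \<open>k\<close>.\<close>
    define \<theta> where "\<theta> i = (if i < card S then f i else 0)" for i
    have "range \<theta> \<subseteq> cbox 0 1"
      using f S(2) by (auto simp: \<theta>_def bij_betw_def mem_box_cart)
    moreover have "\<exists>i<k. \<theta> i = s" if "s \<in> S" for s
    proof -
      from that f obtain i where "i < card S" "f i = s"
        unfolding bij_betw_def by (metis imageE lessThan_iff)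
      then show ?thesis using k by (intro exI[of _ i]) (auto simp: \<theta>_def)
    qed
    moreover have "B j \<subseteq> A" by (auto simp: B_def)
    ultimately show ?thesis using S(4) by (intro exI[of _ \<theta>]) (metis subsetD)
  qed
  then obtain \<theta> :: "nat \<Rightarrow> nat \<Rightarrow> real ^ 'n" where \<theta>: "\<And>j. range (\<theta> j) \<subseteq> cbox 0 1"
    and main: "\<And>j m. (\<And>i. \<bar>m $ i\<bar> < int (N j)) \<Longrightarrow> (\<And>i. i < k \<Longrightarrow> 0 \<le> Re (character (\<theta> j i) m)) \<Longrightarrow>
      \<exists>a\<in>A. \<exists>b\<in>A. \<exists>c\<in>A. \<exists>d\<in>A. m = a + b - c - d"
    by metis
  obtain r l where r: "strict_mono r" and l: "\<And>i. i < k \<Longrightarrow> (\<lambda>j. \<theta> (r j) i) \<longlonglongrightarrow> l i"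
    using common_convergent_subsequence[of "cbox 0 1" \<theta> k] \<theta> by (metis compact_cbox rangeI subsetD)
  show thesis
  proof (rule that)
    show "finite (l ` {..<k})" by simp
    fix m :: "int ^ 'n" assume pos: "\<And>\<theta>. \<theta> \<in> l ` {..<k} \<Longrightarrow> 0 < Re (character \<theta> m)"
    have "\<forall>\<^sub>F j in sequentially. 0 < Re (character (\<theta> (r j) i) m)" if "i < k" for i
    proof (rule order_tendstoD(1))
      show "(\<lambda>j. Re (character (\<theta> (r j) i) m)) \<longlonglongrightarrow> Re (character (l i) m)"
        unfolding Re_character by (intro tendsto_intros l that)
    qed (use pos that in simp)
    then have "\<forall>\<^sub>F j in sequentially. \<forall>i\<in>{..<k}. 0 < Re (character (\<theta> (r j) i) m)"
      by (intro eventually_ball_finite) auto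
    moreover have "\<forall>\<^sub>F j in sequentially. \<forall>i\<in>UNIV. \<bar>m $ i\<bar> < int (N (r j))"
    proof (intro eventually_ball_finite ballI)
      fix i
      show "\<forall>\<^sub>F j in sequentially. \<bar>m $ i\<bar> < int (N (r j))"
        using eventually_ge_at_top[of "nat \<bar>m $ i\<bar>"]
      proof eventually_elim
        case (elim j)
        then show ?case using seq_suble[OF r, of j] by (simp add: N_def)
      qed
    qed simp
    ultimately have "\<forall>\<^sub>F j in sequentially. (\<forall>i\<in>{..<k}. 0 < Re (character (\<theta> (r j) i) m)) \<and>
        (\<forall>i\<in>UNIV. \<bar>m $ i\<bar> < int (N (r j)))"
      by (rule eventually_conj)
    then obtain j where "\<forall>i\<in>{..<k}. 0 < Re (character (\<theta> (r j) i) m)" "\<forall>i\<in>UNIV. \<bar>m $ i\<bar> < int (N (r j))"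
      using eventually_happens trivial_limit_sequentially by blast
    then show "\<exists>a\<in>A. \<exists>b\<in>A. \<exists>c\<in>A. \<exists>d\<in>A. m = a + b - c - d"
      by (intro main[of m "r j"]) (auto intro: less_imp_le)
  qed
qed

section \<open>Orthogonal projections, approximate subgroups and lattices\<close>

definition orth_proj :: "'a::euclidean_space set \<Rightarrow> 'a \<Rightarrow> 'a" where
  "orth_proj L = (SOME p. linear p \<and> range p \<subseteq> L \<and> (\<forall>x. \<forall>l\<in>L. p x \<bullet> l = x \<bullet> l))"

lemma
  assumes "subspace L"
  shows linear_orth_proj: "linear (orth_proj L)"
    and orth_proj_in: "orth_proj L x \<in> L"
    and inner_orth_proj: "l \<in> L \<Longrightarrow> orth_proj L x \<bullet> l = x \<bullet> l"
proof -
  obtain B where B: "B \<subseteq> L" "pairwise orthogonal B" "\<And>x. x \<in> B \<Longrightarrow> norm x = 1"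
    "independent B" "span B = L"
    using orthonormal_basis_subspace[OF assms] by metis
  then have fin: "finite B" using independent_imp_finite by blast
  define p where "p x = (\<Sum>b\<in>B. (x \<bullet> b) *\<^sub>R b)" for x
  have "linear p"
    by (auto simp: p_def intro!: linearI simp: inner_add_left scaleR_add_left sum.distrib scaleR_sum_right)
  moreover have "range p \<subseteq> L"
    unfolding p_def B(5)[symmetric] by (auto intro!: span_sum span_scale intro: span_base)
  moreover have "p x \<bullet> l = x \<bullet> l" if l: "l \<in> L" for x l
  proof -
    have Bp: "p x \<bullet> b = x \<bullet> b" if b: "b \<in> B" for b
    proof -
      have "p x \<bullet> b = (\<Sum>b'\<in>B. if b' = b then x \<bullet> b else 0)"
        unfolding p_def inner_sum_left
      proof (rule sum.cong[OF refl])
        fix b' assume "b' \<in> B"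
        then show "(x \<bullet> b') *\<^sub>R b' \<bullet> b = (if b' = b then x \<bullet> b else 0)"
          using B(2,3) b by (auto simp: pairwise_def orthogonal_def norm_eq_1)
      qed
      then show ?thesis using fin b by simp
    qed
    have "(p x - x) \<bullet> l = 0"
      by (rule orthogonal_to_span[unfolded orthogonal_def, of l B])
        (use l B(5) Bp in \<open>auto simp: inner_diff_left\<close>)
    then show ?thesis by (simp add: inner_diff_left)
  qed
  ultimately have "\<exists>p. linear p \<and> range p \<subseteq> L \<and> (\<forall>x. \<forall>l\<in>L. p x \<bullet> l = x \<bullet> l)" by blast
  from someI_ex[OF this] show "linear (orth_proj L)" "orth_proj L x \<in> L"
    "l \<in> L \<Longrightarrow> orth_proj L x \<bullet> l = x \<bullet> l"
    by (auto simp: orth_proj_def)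
qed

lemma orth_proj_eq:
  assumes "subspace L" "y \<in> L" "\<And>l. l \<in> L \<Longrightarrow> y \<bullet> l = x \<bullet> l"
  shows "orth_proj L x = y"
proof -
  have "orth_proj L x - y \<in> L"
    using assms(1,2) orth_proj_in[OF assms(1)] by (simp add: subspace_diff)
  then have "(orth_proj L x - y) \<bullet> (orth_proj L x - y) = 0"
    using assms by (simp add: inner_diff_left inner_orth_proj)
  then show ?thesis by simp
qed

lemma orth_proj_of_mem: "subspace L \<Longrightarrow> x \<in> L \<Longrightarrow> orth_proj L x = x"
  by (rule orth_proj_eq) auto

lemma norm_diff_orth_proj_le:
  assumes "subspace L"
  shows "norm (x - orth_proj L x) \<le> norm x"
proof -
  have "x \<bullet> x = (x - orth_proj L x) \<bullet> (x - orth_proj L x) + orth_proj L x \<bullet> orth_proj L x"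
    using inner_orth_proj[OF assms orth_proj_in[OF assms, of x], of x]
    by (simp add: algebra_simps inner_commute)
  then show ?thesis by (simp add: norm_le)
qed

lemma inner_orth_proj_orthogonal:
  assumes "subspace L" "orth_proj L w = 0"
  shows "w \<bullet> orth_proj L x = 0"
  using inner_orth_proj[OF assms(1) orth_proj_in[OF assms(1), of x], of w] assms(2) by simp

text \<open>The projection is self-adjoint, so each coordinate of \<open>orth_proj L a\<close> is
  the value at \<open>a\<close> of a functional from \<open>L\<close>; the finitely many coordinates
  bound the norm.\<close>

lemma bounded_orth_proj_image:
  assumes L: "subspace L" and bdd: "\<And>l. l \<in> L \<Longrightarrow> bounded ((\<lambda>a. a \<bullet> l) ` A)"
  shows "bounded (orth_proj L ` A)"
proof -
  have "\<exists>D. \<forall>a\<in>A. \<bar>orth_proj L a \<bullet> b\<bar> \<le> D" for b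
  proof -
    obtain D where "\<forall>a\<in>A. \<bar>a \<bullet> orth_proj L b\<bar> \<le> D"
      using bdd[OF orth_proj_in[OF L, of b]] unfolding bounded_iff by auto
    moreover have "orth_proj L a \<bullet> b = a \<bullet> orth_proj L b" for a
      using inner_orth_proj[OF L orth_proj_in[OF L, of a], of b]
        inner_orth_proj[OF L orth_proj_in[OF L, of b], of a]
      by (simp add: inner_commute)
    ultimately show ?thesis by auto
  qed
  then obtain D where D: "\<And>a b. a \<in> A \<Longrightarrow> \<bar>orth_proj L a \<bullet> b\<bar> \<le> D b" by metis
  have "norm (orth_proj L a) \<le> (\<Sum>b\<in>Basis. D b)" if "a \<in> A" for a
    using norm_le_l1[of "orth_proj L a"] sum_mono[of Basis "\<lambda>b. \<bar>orth_proj L a \<bullet> b\<bar>" D] D[OF that]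
    by force
  then show ?thesis unfolding bounded_iff by blast
qed

text \<open>Greedy descent: as long as \<open>m - x\<close> has a large component orthogonal to \<open>L\<close>, adding to \<open>x\<close> one of
  finitely many elements of \<open>A\<close> shortens this component by a fixed amount.\<close>

lemma approximate_group_near:
  fixes A L :: "'a::euclidean_space set"
  assumes L: "subspace L" and L_eq: "L = {l. bounded ((\<lambda>a. a \<bullet> l) ` A)}"
    and "A \<noteq> {}" and minus: "\<And>a. a \<in> A \<Longrightarrow> - a \<in> A"
    and add: "\<And>a b. a \<in> A \<Longrightarrow> b \<in> A \<Longrightarrow> \<exists>c\<in>A. norm (a + b - c) \<le> C"
  obtains R' where "\<And>m. norm (orth_proj L m) \<le> R \<Longrightarrow> \<exists>x\<in>A. norm (m - x) \<le> R'"
proof -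
  define p where "p = orth_proj L"
  have lin: "linear p" unfolding p_def by (rule linear_orth_proj[OF L])
  obtain a0 where "a0 \<in> A" using \<open>A \<noteq> {}\<close> by blast
  then have C: "0 \<le> C" using add[of a0 a0] by (meson norm_ge_zero order_trans)
  have "bounded (p ` A)"
    unfolding p_def by (rule bounded_orth_proj_image[OF L]) (use L_eq in auto)
  then obtain D where pA: "\<And>a. a \<in> A \<Longrightarrow> norm (p a) \<le> D" unfolding bounded_iff by auto
  define S where "S = {u. norm u = 1 \<and> p u = 0}"
  have "closed {u. p u = 0}"
    using lin by (intro closed_Collect_eq continuous_intros linear_continuous_on)
      (simp add: linear_conv_bounded_linear)
  moreover have "S = sphere 0 1 \<inter> {u. p u = 0}" by (auto simp: S_def)
  ultimately have cS: "compact S" by (metis compact_Int_closed compact_sphere)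
  have op: "\<And>T. T \<in> (\<lambda>a. {u. C + 1 < a \<bullet> u}) ` A \<Longrightarrow> open T"
    by (auto intro!: open_Collect_less continuous_intros)
  \<comment> \<open>A unit vector orthogonal to \<open>L\<close> is not in \<open>L\<close>, hence
    unbounded on \<open>A\<close>; symmetry of \<open>A\<close> removes the absolute value. The
    surplus \<open>1\<close> over \<open>C\<close> survives the error \<open>C\<close> made when
    \<open>x + a\<close> is replaced by an element of \<open>A\<close>.\<close>
  have cov: "S \<subseteq> \<Union>((\<lambda>a. {u. C + 1 < a \<bullet> u}) ` A)"
  proof
    fix u assume u: "u \<in> S"
    then have "u \<notin> L" using orth_proj_of_mem[OF L, of u] by (auto simp: S_def p_def)
    then obtain a where "a \<in> A" "C + 1 < \<bar>a \<bullet> u\<bar>" unfolding L_eq bounded_iff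
      by (auto simp: not_le)
    then have "\<exists>a\<in>A. C + 1 < a \<bullet> u" using minus by (cases "a \<bullet> u \<ge> 0") force+
    then show "u \<in> \<Union>((\<lambda>a. {u. C + 1 < a \<bullet> u}) ` A)" by blast
  qed
  obtain \<C> where \<C>: "\<C> \<subseteq> (\<lambda>a. {u. C + 1 < a \<bullet> u}) ` A" "finite \<C>" "S \<subseteq> \<Union>\<C>"
    using compactE[OF cS cov op] by metis
  obtain A' where A': "A' \<subseteq> A" "finite A'" and \<C>_eq: "\<C> = (\<lambda>a. {u. C + 1 < a \<bullet> u}) ` A'"
    using finite_subset_image[OF \<C>(2,1)] by metis
  have cover: "\<exists>a\<in>A'. C + 1 < a \<bullet> u" if "u \<in> S" for u
    using \<C>(3) that unfolding \<C>_eq by blast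
  obtain M where M: "\<And>a. a \<in> A' \<Longrightarrow> norm a \<le> M"
    using finite_imp_bounded[OF A'(2)] unfolding bounded_iff by blast
  \<comment> \<open>Chosen so that \<open>- 2 * R0 + (M + C)\<^sup>2 = - 1\<close>: this is the
    guaranteed decrease of the squared distance in \<open>descent\<close>.\<close>
  define R0 where "R0 = ((M + C)\<^sup>2 + 1) / 2"
  define q where "q x = x - p x" for x
  have pq: "p (q x) = 0" for x
    using lin orth_proj_of_mem[OF L orth_proj_in[OF L, of x]] by (simp add: q_def linear_diff p_def)
  have inner_q: "q y \<bullet> q x = q y \<bullet> x" for x y
    using inner_orth_proj_orthogonal[OF L pq[unfolded p_def], of y x]
    by (simp add: q_def[of x] p_def inner_diff_right)
  have norm_q: "norm (q x) \<le> norm x" for x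
    unfolding q_def p_def by (rule norm_diff_orth_proj_le[OF L])
  have q_diff: "q (x - y) = q x - q y" for x y
    using lin by (simp add: q_def linear_diff)
  have descent: "\<exists>z\<in>A. (norm (q (m - z)))\<^sup>2 \<le> (norm (q (m - x)))\<^sup>2 - 1"
    if x: "x \<in> A" and R0: "R0 \<le> norm (q (m - x))" for m x
  proof -
    define w where "w = q (m - x)"
    have "0 < R0" by (simp add: R0_def add_nonneg_pos)
    then have w0: "norm w > 0" using R0 unfolding w_def by linarith
    have "(1 / norm w) *\<^sub>R w \<in> S"
      using w0 pq lin by (simp add: S_def w_def linear_scale)
    from cover[OF this] obtain a where a: "a \<in> A'" "C + 1 < a \<bullet> ((1 / norm w) *\<^sub>R w)" by blast
    then have aw: "(C + 1) * norm w < a \<bullet> w" using w0 by (simp add: field_simps)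
    obtain z where z: "z \<in> A" "norm (x + a - z) \<le> C" using add[OF x] a(1) A'(1) by blast
    define v where "v = z - x"
    have v: "norm (a - v) \<le> C" using z(2) by (simp add: v_def algebra_simps)
    have "norm v \<le> M + C"
      using norm_triangle_sub[of v a] M[OF a(1)] v by (simp add: norm_minus_commute)
    then have qv: "(norm (q v))\<^sup>2 \<le> (M + C)\<^sup>2"
      using norm_q[of v] by (intro power_mono) auto
    have "w \<bullet> a - w \<bullet> v \<le> norm w * C"
      using Cauchy_Schwarz_ineq2[of w "a - v"] mult_left_mono[OF v norm_ge_zero[of w]]
      by (simp add: inner_diff_right abs_le_iff)
    then have wv: "norm w \<le> w \<bullet> v" using aw by (simp add: algebra_simps inner_commute)
    have q_mz: "q (m - z) = w - q v" by (simp add: w_def v_def flip: q_diff)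
    have "(norm (q (m - z)))\<^sup>2 = (norm w)\<^sup>2 - 2 * (w \<bullet> q v) + (norm (q v))\<^sup>2"
      unfolding q_mz power2_norm_eq_inner by (simp add: algebra_simps inner_commute)
    also have "w \<bullet> q v = w \<bullet> v" unfolding w_def by (rule inner_q)
    finally have "(norm (q (m - z)))\<^sup>2 \<le> (norm w)\<^sup>2 - 2 * R0 + (M + C)\<^sup>2"
      using wv qv R0 by (simp add: w_def)
    moreover have "2 * R0 = (M + C)\<^sup>2 + 1" by (simp add: R0_def)
    ultimately have "(norm (q (m - z)))\<^sup>2 \<le> (norm (q (m - x)))\<^sup>2 - 1" unfolding w_def by linarith
    then show ?thesis using z(1) by blast
  qed
  show thesis
  proof (rule that)
    fix m assume m: "norm (orth_proj L m) \<le> R"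
    define f where "f x = (norm (q (m - x)))\<^sup>2" for x
    have bb: "bdd_below (f ` A)" by (auto simp: f_def intro: bdd_belowI[of _ 0])
    \<comment> \<open>The infimum need not be attained, but a point within \<open>1\<close> of it
      suffices because a descent step gains \<open>1\<close>.\<close>
    obtain x where x: "x \<in> A" "f x < Inf (f ` A) + 1"
      using cInf_lessD[of "f ` A" "Inf (f ` A) + 1"] \<open>A \<noteq> {}\<close> by auto
    have "norm (q (m - x)) < R0"
    proof (rule ccontr)
      assume "\<not> ?thesis"
      then obtain z where "z \<in> A" "f z \<le> f x - 1" using descent[OF x(1), of m] by (auto simp: f_def not_less)
      moreover have "Inf (f ` A) \<le> f z" using bb \<open>z \<in> A\<close> by (simp add: cINF_lower)
      ultimately show False using x(2) by linarith
    qed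
    moreover have "norm (m - x) \<le> norm (p m) + norm (p x) + norm (q (m - x))"
      using norm_triangle_ineq[of "p (m - x)" "q (m - x)"] norm_triangle_ineq4[of "p m" "p x"] lin
      by (simp add: q_def linear_diff)
    ultimately show "\<exists>x\<in>A. norm (m - x) \<le> R + D + R0"
      using x(1) pA[OF x(1)] m by (intro bexI[of _ x]) (auto simp: p_def)
  qed
qed

text \<open>The image of all integer vectors under \<open>p\<close> may fail to be discrete. So a
  basis \<open>B\<close> of the range is picked among the images of the unit vectors, and
  \<open>\<Lambda>\<close> consists of the integer combinations of lifts of \<open>B\<close>. It
  maps injectively onto the lattice spanned by \<open>B\<close>: coordinates with respect to
  \<open>B\<close> separate its points, and rounding them down approximates any
  \<open>p (rvec m)\<close>.\<close>

lemma lattice_complement: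
  fixes p :: "real ^ 'n \<Rightarrow> 'b::euclidean_space"
  assumes p: "linear p"
  obtains \<Lambda> :: "(int ^ 'n) set" and c R :: real where "0 < c"
    "\<And>x y. x \<in> \<Lambda> \<Longrightarrow> y \<in> \<Lambda> \<Longrightarrow> x - y \<in> \<Lambda>" "0 \<in> \<Lambda>"
    "\<And>x. x \<in> \<Lambda> \<Longrightarrow> norm (p (rvec x)) < c \<Longrightarrow> x = 0"
    "\<And>m. \<exists>x\<in>\<Lambda>. norm (p (rvec (m - x))) \<le> R"
proof -
  define E where "E = (\<lambda>i :: 'n. p (rvec (axis i 1))) ` UNIV"
  obtain B where B: "B \<subseteq> E" "independent B" "E \<subseteq> span B"
    using maximal_independent_subset[of E] by metis
  have fin: "finite B" using B(2) independent_imp_finite by blast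
  have pE: "p v \<in> span B" for v
  proof -
    have "v = (\<Sum>i\<in>UNIV. (v $ i) *\<^sub>R rvec (axis i 1))"
      by (simp add: vec_eq_iff axis_def if_distrib cong: if_cong)
    then have "p v = (\<Sum>i\<in>UNIV. (v $ i) *\<^sub>R p (rvec (axis i 1)))"
      using p by (metis (no_types, lifting) linear_scale linear_sum sum.cong)
    also have "\<dots> \<in> span B"
      using B(3) by (intro span_sum span_scale) (auto simp: E_def)
    finally show ?thesis .
  qed
  have "\<forall>b\<in>B. \<exists>v. p (rvec v) = b" using B(1) by (auto simp: E_def)
  then obtain s where s: "\<And>b. b \<in> B \<Longrightarrow> p (rvec (s b)) = b" by metis
  have "\<exists>g. linear g \<and> (\<forall>b'\<in>B. g b' = (if b' = b then 1 else 0 :: real))" for b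
    using linear_independent_extend[OF B(2), of "\<lambda>b'. if b' = b then 1 else 0"] by blast
  then have "\<forall>b. \<exists>g. linear g \<and> (\<forall>b'\<in>B. g b' = (if b' = b then 1 else 0 :: real))" by blast
  from choice[OF this] obtain g :: "'b \<Rightarrow> 'b \<Rightarrow> real" where lg: "\<And>b. linear (g b)"
    and g: "\<And>b b'. b' \<in> B \<Longrightarrow> g b b' = (if b' = b then 1 else 0)" by blast
  have expand: "v = (\<Sum>b\<in>B. g b v *\<^sub>R b)" if "v \<in> span B" for v
  proof -
    have lin: "linear (\<lambda>v. \<Sum>b\<in>B. g b v *\<^sub>R b)"
      using lg by (auto intro!: linearI simp: linear_add linear_scale scaleR_add_left sum.distrib scaleR_sum_right)
    have "id v = (\<lambda>v. \<Sum>b\<in>B. g b v *\<^sub>R b) v"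
    proof (rule linear_eq_on_span[OF linear_id lin _ that])
      fix b assume "b \<in> B"
      then show "id b = (\<Sum>b'\<in>B. g b' b *\<^sub>R b')"
        using fin by (simp add: g if_distrib[of "\<lambda>t. t *\<^sub>R _"] cong: if_cong)
    qed
    then show ?thesis by simp
  qed
  have "\<exists>K. \<forall>v. \<bar>g b v\<bar> \<le> K * norm v" for b
    using linear_bounded[OF lg[of b]] by auto
  then obtain K where K: "\<And>b v. \<bar>g b v\<bar> \<le> K b * norm v" by metis
  \<comment> \<open>An image shorter than \<open>c\<close> has all coordinates below
    \<open>1\<close> in absolute value, and integers that small are \<open>0\<close>. The summand
    \<open>1\<close> makes the inequality strict and keeps the denominator positive when
    \<open>B\<close> is empty.\<close>
  define c where "c = 1 / (1 + (\<Sum>b\<in>B. \<bar>K b\<bar>))"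
  have S0: "0 \<le> (\<Sum>b\<in>B. \<bar>K b\<bar>)" by (simp add: sum_nonneg)
  then have c: "0 < c" by (simp add: c_def add_pos_nonneg)
  define lat where "lat z = (\<Sum>b\<in>B. vector_scalar_mult (z b) (s b))" for z :: "'b \<Rightarrow> int"
  have rlat: "rvec (lat z) = (\<Sum>b\<in>B. real_of_int (z b) *\<^sub>R rvec (s b))" for z
    unfolding lat_def rvec_sum by (intro sum.cong refl) (simp add: vec_eq_iff)
  have plat: "p (rvec (lat z)) = (\<Sum>b\<in>B. real_of_int (z b) *\<^sub>R b)" for z
    unfolding rlat using p s by (simp add: linear_sum linear_scale)
  show thesis
  proof (rule that[of c "range lat" "\<Sum>b\<in>B. norm b"])
    show "0 < c" by (rule c)
    show "0 \<in> range lat"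
      by (rule range_eqI[of _ _ "\<lambda>_. 0"]) (simp add: lat_def)
    fix x y assume "x \<in> range lat" "y \<in> range lat"
    then obtain z z' where "x = lat z" "y = lat z'" by blast
    then have "x - y = lat (\<lambda>b. z b - z' b)"
      by (simp add: lat_def sum_subtractf[symmetric] vec_eq_iff left_diff_distrib)
    then show "x - y \<in> range lat" by blast
  next
    fix x assume x: "x \<in> range lat" "norm (p (rvec x)) < c"
    then obtain z where z: "x = lat z" by blast
    have "z b = 0" if b: "b \<in> B" for b
    proof -
      have "g b (p (rvec x)) = (\<Sum>b'\<in>B. real_of_int (z b') * g b b')"
        unfolding z plat using lg[of b] by (simp add: linear_sum linear_scale)
      also have "\<dots> = real_of_int (z b)"
        using fin b by (simp add: g if_distrib[of "\<lambda>t. _ * t"] cong: if_cong)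
      finally have "\<bar>real_of_int (z b)\<bar> \<le> \<bar>K b\<bar> * norm (p (rvec x))"
        using K[of b "p (rvec x)"] by (metis abs_ge_self mult_right_mono norm_ge_zero order_trans)
      also have "\<dots> \<le> (\<Sum>b\<in>B. \<bar>K b\<bar>) * norm (p (rvec x))"
        using fin b by (intro mult_right_mono member_le_sum) auto
      also have "\<dots> \<le> (\<Sum>b\<in>B. \<bar>K b\<bar>) * c"
        using x(2) S0 by (intro mult_left_mono) auto
      also have "\<dots> < 1" using c by (simp add: c_def pos_divide_less_eq)
      finally show ?thesis by linarith
    qed
    then show "x = 0" by (simp add: z lat_def)
  next
    fix m :: "int ^ 'n"
    define z where "z b = \<lfloor>g b (p (rvec m))\<rfloor>" for b
    have "p (rvec (m - lat z)) = (\<Sum>b\<in>B. g b (p (rvec m)) *\<^sub>R b) - (\<Sum>b\<in>B. real_of_int (z b) *\<^sub>R b)"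
      using p expand[OF pE, of "rvec m"] by (simp add: rvec_diff linear_diff plat)
    also have "\<dots> = (\<Sum>b\<in>B. frac (g b (p (rvec m))) *\<^sub>R b)"
      by (simp add: z_def frac_def scaleR_left_diff_distrib sum_subtractf)
    also have "norm \<dots> \<le> (\<Sum>b\<in>B. norm b)"
    proof (rule sum_norm_le)
      fix b show "norm (frac (g b (p (rvec m))) *\<^sub>R b) \<le> norm b"
        using frac_lt_1[of "g b (p (rvec m))"] by (simp add: mult_left_le_one_le less_imp_le)
    qed
    finally show "\<exists>x\<in>range lat. norm (p (rvec (m - x))) \<le> (\<Sum>b\<in>B. norm b)" by blast
  qed
qed

section \<open>Group topologies and precompact sets\<close>

text \<open>Continuity of subtraction, reduced to neighbourhoods of \<open>0\<close> by translation
  invariance. Non-Hausdorff topologies are included, since a homomorphism with non-trivial kernel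
  pulls back to one.\<close>

definition group_topology :: "'a::ab_group_add topology \<Rightarrow> bool" where
  "group_topology \<tau> \<longleftrightarrow> topspace \<tau> = UNIV \<and>
     (\<forall>U x. openin \<tau> U \<longrightarrow> openin \<tau> ((+) x ` U)) \<and>
     (\<forall>U. openin \<tau> U \<longrightarrow> 0 \<in> U \<longrightarrow> (\<exists>V. openin \<tau> V \<and> 0 \<in> V \<and> (\<forall>x\<in>V. \<forall>y\<in>V. x - y \<in> U)))"

text \<open>Total boundedness for the group uniformity. It stands for relative compactness of the
  image in the locally compact group, but is formulated inside the source group.\<close>

definition precompact :: "'a::ab_group_add topology \<Rightarrow> 'a set \<Rightarrow> bool" where
  "precompact \<tau> S \<longleftrightarrow>
     (\<forall>U. openin \<tau> U \<longrightarrow> 0 \<in> U \<longrightarrow> (\<exists>F. finite F \<and> (\<forall>s\<in>S. \<exists>f\<in>F. s - f \<in> U)))"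

lemma group_topology_topspace: "group_topology \<tau> \<Longrightarrow> topspace \<tau> = UNIV"
  by (simp add: group_topology_def)

lemma group_topology_diff:
  assumes "group_topology \<tau>" "openin \<tau> U" "0 \<in> U"
  obtains V where "openin \<tau> V" "0 \<in> V" "\<And>x y. x \<in> V \<Longrightarrow> y \<in> V \<Longrightarrow> x - y \<in> U"
  using assms unfolding group_topology_def by metis

lemma group_topology_add:
  assumes "group_topology \<tau>" "openin \<tau> U" "0 \<in> U"
  obtains V where "openin \<tau> V" "0 \<in> V" "\<And>x y. x \<in> V \<Longrightarrow> y \<in> V \<Longrightarrow> x + y \<in> U" "V \<subseteq> U"
proof -
  obtain V where V: "openin \<tau> V" "0 \<in> V" "\<And>x y. x \<in> V \<Longrightarrow> y \<in> V \<Longrightarrow> x - y \<in> U"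
    using group_topology_diff[OF assms] by metis
  obtain W where W: "openin \<tau> W" "0 \<in> W" "\<And>x y. x \<in> W \<Longrightarrow> y \<in> W \<Longrightarrow> x - y \<in> V"
    using group_topology_diff[OF assms(1) V(1,2)] by metis
  show thesis
  proof (rule that[of W])
    fix x y assume "x \<in> W" "y \<in> W"
    then have "x - 0 \<in> V" "0 - y \<in> V" using W(2,3) by blast+
    then show "x + y \<in> U" using V(3)[of x "- y"] by simp
  next
    show "W \<subseteq> U" using W(2,3) V(2,3) by (metis diff_zero subsetI)
  qed (use W in auto)
qed

text \<open>Translations preserve openness on both sides, so comparing neighbourhoods of
  \<open>0\<close> is enough.\<close>

lemma coarser_group_topologyI:
  assumes \<tau>: "group_topology \<tau>" and \<tau>': "group_topology \<tau>'"
    and nbhd: "\<And>U. openin \<tau> U \<Longrightarrow> 0 \<in> U \<Longrightarrow> \<exists>V. openin \<tau>' V \<and> 0 \<in> V \<and> V \<subseteq> U"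
  shows "coarser \<tau> \<tau>'"
  unfolding coarser_def
proof safe
  fix U assume U: "openin \<tau> U"
  show "openin \<tau>' U"
  proof (subst openin_subopen, intro ballI)
    fix x assume "x \<in> U"
    then have "0 \<in> (+) (- x) ` U" by (force simp: image_iff)
    moreover have "openin \<tau> ((+) (- x) ` U)"
      using U \<tau> unfolding group_topology_def by blast
    ultimately obtain V where V: "openin \<tau>' V" "0 \<in> V" "V \<subseteq> (+) (- x) ` U"
      using nbhd by blast
    have "openin \<tau>' ((+) x ` V)" using V(1) \<tau>' by (auto simp: group_topology_def)
    moreover have "x \<in> (+) x ` V" using V(2) by (auto simp: image_iff)
    moreover have "(+) x ` V \<subseteq> U" using V(3) by fastforce
    ultimately show "\<exists>T. openin \<tau>' T \<and> x \<in> T \<and> T \<subseteq> U" by blast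
  qed
qed

lemma coarser_antisym: "coarser \<tau> \<tau>' \<Longrightarrow> coarser \<tau>' \<tau> \<Longrightarrow> \<tau> = \<tau>'"
  by (auto simp: coarser_def topology_eq)

lemma precompactD:
  assumes "precompact \<tau> S" "openin \<tau> U" "0 \<in> U"
  obtains F where "finite F" "\<And>s. s \<in> S \<Longrightarrow> \<exists>f\<in>F. s - f \<in> U"
  using assms unfolding precompact_def by metis

lemma precompact_subset: "precompact \<tau> S \<Longrightarrow> T \<subseteq> S \<Longrightarrow> precompact \<tau> T"
  unfolding precompact_def by (meson subsetD)

lemma precompact_finite: "finite S \<Longrightarrow> precompact \<tau> S"
  unfolding precompact_def by (metis diff_self)

lemma precompact_Un:
  assumes "precompact \<tau> S" "precompact \<tau> T"
  shows "precompact \<tau> (S \<union> T)"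
  unfolding precompact_def
proof (intro allI impI)
  fix U assume U: "openin \<tau> U" "0 \<in> U"
  obtain F where F: "finite F" "\<And>s. s \<in> S \<Longrightarrow> \<exists>f\<in>F. s - f \<in> U"
    using precompactD[OF assms(1) U] by metis
  obtain F' where F': "finite F'" "\<And>s. s \<in> T \<Longrightarrow> \<exists>f\<in>F'. s - f \<in> U"
    using precompactD[OF assms(2) U] by metis
  show "\<exists>F. finite F \<and> (\<forall>s\<in>S \<union> T. \<exists>f\<in>F. s - f \<in> U)"
    using F F' by (intro exI[of _ "F \<union> F'"]) blast
qed

lemma precompact_diff:
  assumes \<tau>: "group_topology \<tau>" and S: "precompact \<tau> S" and T: "precompact \<tau> T"
  shows "precompact \<tau> {s - t | s t. s \<in> S \<and> t \<in> T}"
  unfolding precompact_def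
proof (intro allI impI)
  fix U assume U: "openin \<tau> U" "0 \<in> U"
  obtain V where V: "openin \<tau> V" "0 \<in> V" "\<And>x y. x \<in> V \<Longrightarrow> y \<in> V \<Longrightarrow> x - y \<in> U"
    using group_topology_diff[OF \<tau> U] by metis
  obtain F where F: "finite F" "\<And>s. s \<in> S \<Longrightarrow> \<exists>f\<in>F. s - f \<in> V"
    using precompactD[OF S V(1,2)] by metis
  obtain F' where F': "finite F'" "\<And>s. s \<in> T \<Longrightarrow> \<exists>f\<in>F'. s - f \<in> V"
    using precompactD[OF T V(1,2)] by metis
  have "\<exists>f\<in>(\<lambda>(f, f'). f - f') ` (F \<times> F'). (s - t) - f \<in> U" if s: "s \<in> S" and t: "t \<in> T" for s t
  proof -
    obtain f f' where f: "f \<in> F" "s - f \<in> V" "f' \<in> F'" "t - f' \<in> V"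
      using F(2)[OF s] F'(2)[OF t] by blast
    from V(3)[OF f(2,4)] have "(s - t) - (f - f') \<in> U" by (simp add: algebra_simps)
    then show ?thesis using f(1,3) by (intro bexI[of _ "f - f'"]) auto
  qed
  then show "\<exists>F. finite F \<and> (\<forall>s\<in>{s - t | s t. s \<in> S \<and> t \<in> T}. \<exists>f\<in>F. s - f \<in> U)"
    using F(1) F'(1) by (intro exI[of _ "(\<lambda>(f, f'). f - f') ` (F \<times> F')"]) blast
qed

lemma precompact_uminus:
  assumes "group_topology \<tau>" "precompact \<tau> S"
  shows "precompact \<tau> (uminus ` S)"
proof -
  have "uminus ` S \<subseteq> {s - t | s t. s \<in> {0} \<and> t \<in> S}" by force
  then show ?thesis
    using precompact_diff[OF assms(1) precompact_finite[of "{0}"] assms(2)] precompact_subset by blast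
qed

lemma precompact_add:
  assumes "group_topology \<tau>" "precompact \<tau> S" "precompact \<tau> T"
  shows "precompact \<tau> {s + t | s t. s \<in> S \<and> t \<in> T}"
proof -
  have "{s + t | s t. s \<in> S \<and> t \<in> T} \<subseteq> {s - t | s t. s \<in> S \<and> t \<in> uminus ` T}"
    by clarsimp (metis diff_minus_eq_add image_eqI)
  then show ?thesis
    using precompact_diff[OF assms(1,2) precompact_uminus[OF assms(1,3)]] precompact_subset by blast
qed

text \<open>Finitely many translates of \<open>U\<close> cover \<open>S\<close>. This spreads
  boundedness from a neighbourhood of \<open>0\<close> to all precompact sets and makes
  \<open>bounded_functionals\<close> a usable invariant.\<close>

lemma bounded_on_precompact:
  fixes f :: "'a::ab_group_add \<Rightarrow> 'b::real_normed_vector"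
  assumes add: "\<And>x y. f (x + y) = f x + f y" and S: "precompact \<tau> S"
    and U: "openin \<tau> U" "0 \<in> U" "bounded (f ` U)"
  shows "bounded (f ` S)"
proof -
  obtain F where F: "finite F" "\<And>s. s \<in> S \<Longrightarrow> \<exists>x\<in>F. s - x \<in> U"
    using precompactD[OF S U(1,2)] by metis
  have "f ` S \<subseteq> (\<lambda>(a, b). a + b) ` (f ` F \<times> f ` U)"
  proof safe
    fix s assume "s \<in> S"
    then obtain x where x: "x \<in> F" "s - x \<in> U" using F(2) by blast
    have "f s = f x + f (s - x)" using add[of x "s - x"] by simp
    then show "f s \<in> (\<lambda>(a, b). a + b) ` (f ` F \<times> f ` U)" using x by force
  qed
  moreover have "bounded ((\<lambda>(a, b). a + b) ` (f ` F \<times> f ` U))"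
    using bounded_plus[OF finite_imp_bounded[OF finite_imageI[OF F(1)]] U(3)] by simp
  ultimately show ?thesis by (rule bounded_subset[rotated])
qed

text \<open>If \<open>x + x\<close> lies in a set where \<open>f\<close> is bounded by
  \<open>C\<close>, then \<open>f x\<close> is bounded by \<open>C / 2\<close>; repeated shrinking
  halves the bound as often as desired.\<close>

lemma small_near_0:
  fixes f :: "'a::ab_group_add \<Rightarrow> 'b::real_normed_vector"
  assumes \<tau>: "group_topology \<tau>" and add: "\<And>x y. f (x + y) = f x + f y"
    and U: "openin \<tau> U" "0 \<in> U" "bounded (f ` U)" and "0 < e"
  obtains V where "openin \<tau> V" "0 \<in> V" "\<And>x. x \<in> V \<Longrightarrow> norm (f x) < e"
proof -
  obtain C where C: "0 < C" "\<And>x. x \<in> U \<Longrightarrow> norm (f x) \<le> C"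
    using U(3) unfolding bounded_pos by auto
  have "\<exists>V. openin \<tau> V \<and> 0 \<in> V \<and> (\<forall>x\<in>V. norm (f x) \<le> C / 2 ^ k)" for k
  proof (induction k)
    case 0
    then show ?case using U C by auto
  next
    case (Suc k)
    then obtain V where V: "openin \<tau> V" "0 \<in> V" "\<And>x. x \<in> V \<Longrightarrow> norm (f x) \<le> C / 2 ^ k" by blast
    obtain W where W: "openin \<tau> W" "0 \<in> W" "\<And>x y. x \<in> W \<Longrightarrow> y \<in> W \<Longrightarrow> x + y \<in> V"
      using group_topology_add[OF \<tau> V(1,2)] by metis
    have "norm (f x) \<le> C / 2 ^ Suc k" if "x \<in> W" for x
      using V(3)[OF W(3)[OF that that]] norm_scaleR[of 2 "f x"] by (simp add: add field_simps flip: scaleR_2)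
    then show ?case using W by blast
  qed
  moreover obtain k where "C / e < 2 ^ k" using real_arch_pow[of 2 "C / e"] by auto
  then have "C / 2 ^ k < e" using \<open>0 < e\<close> by (simp add: field_simps)
  ultimately show thesis using that by (meson le_less_trans)
qed

section \<open>Topologies pulled back along homomorphisms into topological groups\<close>

lemma topological_group_left_div:
  assumes "topological_group H TH"
  shows "continuous_map (prod_topology TH TH) TH (\<lambda>(a, b). inv\<^bsub>H\<^esub> a \<otimes>\<^bsub>H\<^esub> b)"
proof -
  have m: "continuous_map (prod_topology TH TH) TH (\<lambda>(x, y). x \<otimes>\<^bsub>H\<^esub> y)"
    and i: "continuous_map TH TH (\<lambda>x. inv\<^bsub>H\<^esub> x)"
    using assms by (auto simp: topological_group_def)
  have "continuous_map (prod_topology TH TH) (prod_topology TH TH) (\<lambda>(x, y). (inv\<^bsub>H\<^esub> x, y))"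
    using i by (simp add: continuous_map_prod_top)
  from continuous_map_compose[OF this m] show ?thesis
    by (simp add: o_def case_prod_unfold)
qed

lemma topological_group_translate:
  assumes "topological_group H TH" and h: "h \<in> carrier H" and "openin TH W"
  shows "openin TH {y \<in> carrier H. inv\<^bsub>H\<^esub> h \<otimes>\<^bsub>H\<^esub> y \<in> W}"
proof -
  have sp: "topspace TH = carrier H" using assms(1) by (simp add: topological_group_def)
  have "continuous_map TH (prod_topology TH TH) (\<lambda>y. (h, y))"
    using h sp by (simp add: continuous_map_paired)
  from continuous_map_compose[OF this topological_group_left_div[OF assms(1)]]
  have "continuous_map TH TH (\<lambda>y. inv\<^bsub>H\<^esub> h \<otimes>\<^bsub>H\<^esub> y)" by (simp add: o_def)
  from openin_continuous_map_preimage[OF this assms(3)] show ?thesis by (simp add: sp)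
qed

lemma topological_group_small_div:
  assumes H: "topological_group H TH" and W: "openin TH W" "\<one>\<^bsub>H\<^esub> \<in> W"
  obtains D where "openin TH D" "\<one>\<^bsub>H\<^esub> \<in> D" "\<And>a b. a \<in> D \<Longrightarrow> b \<in> D \<Longrightarrow> inv\<^bsub>H\<^esub> a \<otimes>\<^bsub>H\<^esub> b \<in> W"
proof -
  interpret group H using H by (simp add: topological_group_def)
  have sp: "topspace TH = carrier H" using H by (simp add: topological_group_def)
  define Z where "Z = {z \<in> carrier H \<times> carrier H. (\<lambda>(a, b). inv\<^bsub>H\<^esub> a \<otimes>\<^bsub>H\<^esub> b) z \<in> W}"
  have Z: "openin (prod_topology TH TH) Z"
    using openin_continuous_map_preimage[OF topological_group_left_div[OF H] W(1)] by (simp add: sp Z_def)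
  have one: "(\<one>\<^bsub>H\<^esub>, \<one>\<^bsub>H\<^esub>) \<in> Z"
    using W(2) by (simp add: Z_def)
  from openin_prod_topology_alt[THEN iffD1, rule_format, OF Z one]
  obtain U V where UV: "openin TH U" "openin TH V" "\<one>\<^bsub>H\<^esub> \<in> U" "\<one>\<^bsub>H\<^esub> \<in> V" "U \<times> V \<subseteq> Z"
    by (elim exE conjE)
  show thesis
  proof (rule that[of "U \<inter> V"])
    fix a b assume "a \<in> U \<inter> V" "b \<in> U \<inter> V"
    then have "(a, b) \<in> U \<times> V" by simp
    then have "(a, b) \<in> Z" using UV(5) by blast
    then show "inv\<^bsub>H\<^esub> a \<otimes>\<^bsub>H\<^esub> b \<in> W" by (simp add: Z_def)
  qed (use UV in auto)
qed

context
  fixes H :: "('b, 'k) monoid_scheme" and TH and \<eta> :: "'a::ab_group_add \<Rightarrow> 'b"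
  assumes H: "topological_group H TH"
    and carrier: "\<And>x. \<eta> x \<in> carrier H" and add: "\<And>x y. \<eta> (x + y) = \<eta> x \<otimes>\<^bsub>H\<^esub> \<eta> y"
begin

interpretation group H using H by (simp add: topological_group_def)

lemma hom_0: "\<eta> 0 = \<one>\<^bsub>H\<^esub>"
  using add[of 0 0] carrier[of 0] by (simp add: l_cancel_one)

text \<open>The target is not assumed abelian. The left quotient is the form that fits the left
  translates used as neighbourhoods.\<close>

lemma hom_diff: "\<eta> (x - y) = inv\<^bsub>H\<^esub> (\<eta> y) \<otimes>\<^bsub>H\<^esub> \<eta> x"
proof -
  have "\<eta> (- y) = inv\<^bsub>H\<^esub> (\<eta> y)"
    using add[of "- y" y] carrier by (intro inv_equality[symmetric]) (simp_all add: hom_0)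
  then show ?thesis using add[of "- y" x] by simp
qed

lemma group_topology_pullback: "group_topology (pullback_topology UNIV \<eta> TH)"
proof -
  have sp: "topspace TH = carrier H" using H by (simp add: topological_group_def)
  show ?thesis
    unfolding group_topology_def
  proof (intro conjI allI impI)
    show "topspace (pullback_topology UNIV \<eta> TH) = UNIV"
      using carrier by (auto simp: topspace_pullback_topology sp)
  next
    fix U x assume "openin (pullback_topology UNIV \<eta> TH) U"
    then obtain W where W: "openin TH W" "U = \<eta> -` W" by (auto simp: openin_pullback_topology)
    have "y \<in> (+) x ` U \<longleftrightarrow> \<eta> y \<in> {y \<in> carrier H. inv\<^bsub>H\<^esub> (\<eta> x) \<otimes>\<^bsub>H\<^esub> y \<in> W}" for y
    proof -
      have "y \<in> (+) x ` U \<longleftrightarrow> y - x \<in> U"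
        by (metis add_diff_cancel_left' diff_add_cancel add.commute image_iff)
      then show ?thesis by (simp add: W(2) hom_diff carrier)
    qed
    then have "(+) x ` U = \<eta> -` {y \<in> carrier H. inv\<^bsub>H\<^esub> (\<eta> x) \<otimes>\<^bsub>H\<^esub> y \<in> W} \<inter> UNIV" by blast
    then show "openin (pullback_topology UNIV \<eta> TH) ((+) x ` U)"
      using topological_group_translate[OF H carrier W(1)] unfolding openin_pullback_topology by blast
  next
    fix U :: "'a set" assume "openin (pullback_topology UNIV \<eta> TH) U" "0 \<in> U"
    then obtain W where W: "openin TH W" "U = \<eta> -` W" "\<one>\<^bsub>H\<^esub> \<in> W"
      by (auto simp: openin_pullback_topology hom_0)
    obtain D where D: "openin TH D" "\<one>\<^bsub>H\<^esub> \<in> D"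
        "\<And>a b. a \<in> D \<Longrightarrow> b \<in> D \<Longrightarrow> inv\<^bsub>H\<^esub> a \<otimes>\<^bsub>H\<^esub> b \<in> W"
      using topological_group_small_div[OF H W(1,3)] by metis
    show "\<exists>V. openin (pullback_topology UNIV \<eta> TH) V \<and> 0 \<in> V \<and> (\<forall>x\<in>V. \<forall>y\<in>V. x - y \<in> U)"
      by (rule exI[of _ "\<eta> -` D"]) (use D in \<open>auto simp: openin_pullback_topology hom_0 W(2) hom_diff\<close>)
  qed
qed

text \<open>Finitely many left translates of a small \<open>D\<close> cover \<open>K\<close>. Their
  centres \<open>h\<close> need not lie in the image of \<open>\<eta>\<close>, so each is replaced
  by a point \<open>z h\<close> mapped into the same translate; \<open>h\<close> cancels in the left
  quotient of two such points.\<close>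

lemma precompact_preimage:
  assumes K: "compactin TH K"
  shows "precompact (pullback_topology UNIV \<eta> TH) {x. \<eta> x \<in> K}"
  unfolding precompact_def
proof (intro allI impI)
  have sp: "topspace TH = carrier H" using H by (simp add: topological_group_def)
  have KH: "K \<subseteq> carrier H" using compactin_subset_topspace[OF K] sp by simp
  fix U :: "'a set" assume "openin (pullback_topology UNIV \<eta> TH) U" "0 \<in> U"
  then obtain W where W: "openin TH W" "U = \<eta> -` W" "\<one>\<^bsub>H\<^esub> \<in> W"
    by (auto simp: openin_pullback_topology hom_0)
  obtain D where D: "openin TH D" "\<one>\<^bsub>H\<^esub> \<in> D"
      "\<And>a b. a \<in> D \<Longrightarrow> b \<in> D \<Longrightarrow> inv\<^bsub>H\<^esub> a \<otimes>\<^bsub>H\<^esub> b \<in> W"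
    using topological_group_small_div[OF H W(1,3)] by metis
  define N where "N h = {y \<in> carrier H. inv\<^bsub>H\<^esub> h \<otimes>\<^bsub>H\<^esub> y \<in> D}" for h
  have "\<And>S. S \<in> N ` K \<Longrightarrow> openin TH S"
    unfolding N_def using topological_group_translate[OF H _ D(1)] KH by auto
  moreover have "K \<subseteq> \<Union> (N ` K)"
  proof
    fix h assume "h \<in> K"
    then have "h \<in> N h" using KH D(2) by (auto simp: N_def)
    then show "h \<in> \<Union> (N ` K)" using \<open>h \<in> K\<close> by blast
  qed
  ultimately have "\<exists>\<F>. finite \<F> \<and> \<F> \<subseteq> N ` K \<and> K \<subseteq> \<Union>\<F>"
    using K unfolding compactin_def by blast
  then obtain \<F> where \<F>: "finite \<F>" "\<F> \<subseteq> N ` K" "K \<subseteq> \<Union>\<F>" by blast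
  obtain K' where K': "K' \<subseteq> K" "finite K'" "\<F> = N ` K'"
    using finite_subset_image[OF \<F>(1,2)] by metis
  \<comment> \<open>Where no point is mapped into \<open>N h\<close> the choice is arbitrary; such
    \<open>h\<close> are never selected below, as \<open>\<eta> x\<close> itself lies in
    \<open>N h\<close>.\<close>
  define z where "z h = (SOME x. \<eta> x \<in> N h)" for h
  show "\<exists>F. finite F \<and> (\<forall>s\<in>{x. \<eta> x \<in> K}. \<exists>f\<in>F. s - f \<in> U)"
  proof (intro exI conjI ballI)
    show "finite (z ` K')" using K'(2) by simp
    fix x assume "x \<in> {x. \<eta> x \<in> K}"
    then obtain h where h: "h \<in> K'" "\<eta> x \<in> N h" using \<F>(3) K'(3) by auto
    have hH: "h \<in> carrier H" using h(1) K'(1) KH by blast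
    have zh: "\<eta> (z h) \<in> N h" unfolding z_def by (rule someI[of "\<lambda>x. \<eta> x \<in> N h", OF h(2)])
    have "inv\<^bsub>H\<^esub> (inv\<^bsub>H\<^esub> h \<otimes>\<^bsub>H\<^esub> \<eta> (z h)) \<otimes>\<^bsub>H\<^esub> (inv\<^bsub>H\<^esub> h \<otimes>\<^bsub>H\<^esub> \<eta> x) \<in> W"
      using D(3) zh h(2) by (simp add: N_def)
    also have "inv\<^bsub>H\<^esub> (inv\<^bsub>H\<^esub> h \<otimes>\<^bsub>H\<^esub> \<eta> (z h)) \<otimes>\<^bsub>H\<^esub> (inv\<^bsub>H\<^esub> h \<otimes>\<^bsub>H\<^esub> \<eta> x)
        = inv\<^bsub>H\<^esub> (\<eta> (z h)) \<otimes>\<^bsub>H\<^esub> (h \<otimes>\<^bsub>H\<^esub> (inv\<^bsub>H\<^esub> h \<otimes>\<^bsub>H\<^esub> \<eta> x))"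
      using hH carrier by (simp add: inv_mult_group m_assoc)
    also have "h \<otimes>\<^bsub>H\<^esub> (inv\<^bsub>H\<^esub> h \<otimes>\<^bsub>H\<^esub> \<eta> x) = \<eta> x"
      using hH carrier m_assoc[of h "inv\<^bsub>H\<^esub> h" "\<eta> x"] by simp
    also have "inv\<^bsub>H\<^esub> (\<eta> (z h)) \<otimes>\<^bsub>H\<^esub> \<eta> x = \<eta> (x - z h)" by (simp add: hom_diff)
    finally show "\<exists>f\<in>z ` K'. x - f \<in> U" using h(1) by (auto simp: W(2))
  qed
qed

lemma precompact_nbhd:
  assumes "locally_compact_space TH"
  obtains U where "openin (pullback_topology UNIV \<eta> TH) U" "0 \<in> U"
    "precompact (pullback_topology UNIV \<eta> TH) U"
proof -
  have "\<one>\<^bsub>H\<^esub> \<in> topspace TH" using H by (simp add: topological_group_def)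
  then obtain W K where W: "openin TH W" "compactin TH K" "\<one>\<^bsub>H\<^esub> \<in> W" "W \<subseteq> K"
    using assms unfolding locally_compact_space_def by blast
  show thesis
  proof (rule that)
    show "openin (pullback_topology UNIV \<eta> TH) (\<eta> -` W)"
      using W(1) by (auto simp: openin_pullback_topology)
    show "precompact (pullback_topology UNIV \<eta> TH) (\<eta> -` W)"
      using W(4) by (intro precompact_subset[OF precompact_preimage[OF W(2)]]) auto
  qed (use W(3) in \<open>simp add: hom_0\<close>)
qed

end

lemma coarser_pullback_iff:
  assumes "topspace \<sigma> = UNIV" "\<And>x. \<eta> x \<in> topspace TH"
  shows "coarser (pullback_topology UNIV \<eta> TH) \<sigma> \<longleftrightarrow> continuous_map \<sigma> TH \<eta>"
  using assms unfolding continuous_map_def coarser_def openin_pullback_topology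
  by (auto simp: vimage_def)

section \<open>The Bohr topology relative to a subspace\<close>

text \<open>The first factor is the whole space and not \<open>L\<close>, so that one group serves
  all subspaces. The second is a power of the circle with one factor for each
  \<open>\<theta>\<close>; the closure of the characters of the integer vectors in it is their Bohr
  compactification.\<close>

definition bohr_group :: "((real ^ 'n) \<times> (real ^ 'n \<Rightarrow> complex)) monoid" where
  "bohr_group = \<lparr>carrier = UNIV \<times> {z. \<forall>\<theta>. norm (z \<theta>) = 1},
     monoid.mult = (\<lambda>(v, z) (w, y). (v + w, \<lambda>\<theta>. z \<theta> * y \<theta>)), one = (0, \<lambda>_. 1)\<rparr>"

definition bohr_group_top :: "((real ^ 'n) \<times> (real ^ 'n \<Rightarrow> complex)) topology" where
  "bohr_group_top =
     prod_topology euclidean (product_topology (\<lambda>_. top_of_set (sphere 0 1)) UNIV)"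

lemma group_bohr_group: "group (bohr_group :: ((real ^ 'n) \<times> (real ^ 'n \<Rightarrow> complex)) monoid)"
proof (rule groupI)
  fix x :: "((real ^ 'n) \<times> (real ^ 'n \<Rightarrow> complex))" assume "x \<in> carrier bohr_group"
  then show "\<exists>y\<in>carrier bohr_group. y \<otimes>\<^bsub>bohr_group\<^esub> x = \<one>\<^bsub>bohr_group\<^esub>"
    by (intro bexI[of _ "(- fst x, \<lambda>\<theta>. cnj (snd x \<theta>))"])
      (auto simp: bohr_group_def fun_eq_iff mult.commute[of "cnj _"] simp flip: complex_norm_square)
qed (auto simp: bohr_group_def norm_mult fun_eq_iff algebra_simps)

lemma inv_bohr_group:
  fixes x :: "((real ^ 'n) \<times> (real ^ 'n \<Rightarrow> complex))"
  assumes "x \<in> carrier bohr_group"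
  shows "inv\<^bsub>bohr_group\<^esub> x = (- fst x, \<lambda>\<theta>. cnj (snd x \<theta>))"
  using assms
  by (intro group.inv_equality[OF group_bohr_group])
    (auto simp: bohr_group_def fun_eq_iff mult.commute[of "cnj _"] simp flip: complex_norm_square)

lemma topspace_bohr_group_top: "topspace bohr_group_top = carrier (bohr_group :: ((real ^ 'n) \<times> (real ^ 'n \<Rightarrow> complex)) monoid)"
  by (auto simp: bohr_group_top_def bohr_group_def PiE_iff)

lemma continuous_map_bohr_group_top_iff:
  "continuous_map X (bohr_group_top :: ((real ^ 'n) \<times> (real ^ 'n \<Rightarrow> complex)) topology) f \<longleftrightarrow> continuous_map X euclidean (\<lambda>x. fst (f x)) \<and>
     (\<forall>\<theta>. continuous_map X (top_of_set (sphere 0 1)) (\<lambda>x. snd (f x) \<theta>))"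
  by (simp add: bohr_group_top_def continuous_map_pairwise o_def continuous_map_componentwise_UNIV)

lemma locally_compact_group_bohr: "locally_compact_group (bohr_group :: ((real ^ 'n) \<times> (real ^ 'n \<Rightarrow> complex)) monoid) bohr_group_top"
proof -
  let ?X = "prod_topology (bohr_group_top :: ((real ^ 'n) \<times> (real ^ 'n \<Rightarrow> complex)) topology) (bohr_group_top :: ((real ^ 'n) \<times> (real ^ 'n \<Rightarrow> complex)) topology)"
  have id: "continuous_map bohr_group_top bohr_group_top (\<lambda>x :: ((real ^ 'n) \<times> (real ^ 'n \<Rightarrow> complex)). x)" by simp
  have v: "continuous_map bohr_group_top euclidean (fst :: ((real ^ 'n) \<times> (real ^ 'n \<Rightarrow> complex)) \<Rightarrow> _)"
    and z: "continuous_map bohr_group_top (top_of_set (sphere 0 1)) (\<lambda>x :: ((real ^ 'n) \<times> (real ^ 'n \<Rightarrow> complex)). snd x \<theta>)" for \<theta> :: "real ^ 'n"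
    using id unfolding continuous_map_bohr_group_top_iff by auto
  have z': "continuous_map bohr_group_top euclidean (\<lambda>x :: ((real ^ 'n) \<times> (real ^ 'n \<Rightarrow> complex)). snd x \<theta>)"
    and sph: "x \<in> topspace bohr_group_top \<Longrightarrow> norm (snd x \<theta>) = 1" for \<theta> :: "real ^ 'n" and x :: "((real ^ 'n) \<times> (real ^ 'n \<Rightarrow> complex))"
    using z[of \<theta>] by (auto simp: continuous_map_in_subtopology)
  have mult: "continuous_map ?X bohr_group_top (\<lambda>(x, y). x \<otimes>\<^bsub>bohr_group\<^esub> y)"
    unfolding continuous_map_bohr_group_top_iff
  proof (intro conjI allI)
    have "continuous_map ?X (prod_topology euclidean euclidean) (\<lambda>w. (fst (fst w), fst (snd w)))"
      unfolding continuous_map_paired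
      by (intro conjI continuous_map_compose[OF continuous_map_fst v, unfolded o_def]
          continuous_map_compose[OF continuous_map_snd v, unfolded o_def])
    then have "continuous_map ?X euclidean ((\<lambda>(a, b). a + b) \<circ> (\<lambda>w. (fst (fst w), fst (snd w))))"
      by (rule continuous_map_compose)
        (auto simp: case_prod_unfold intro!: continuous_intros)
    then show "continuous_map ?X euclidean (\<lambda>w. fst ((\<lambda>(x, y). x \<otimes>\<^bsub>bohr_group\<^esub> y) w))"
      by (simp add: o_def case_prod_unfold bohr_group_def)
  next
    fix \<theta> :: "real ^ 'n"
    have "continuous_map ?X (prod_topology euclidean euclidean) (\<lambda>w. (snd (fst w) \<theta>, snd (snd w) \<theta>))"
      unfolding continuous_map_paired
      by (intro conjI continuous_map_compose[OF continuous_map_fst z', unfolded o_def]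
          continuous_map_compose[OF continuous_map_snd z', unfolded o_def])
    then have "continuous_map ?X euclidean ((\<lambda>(a, b). a * b) \<circ> (\<lambda>w. (snd (fst w) \<theta>, snd (snd w) \<theta>)))"
      by (rule continuous_map_compose)
        (auto simp: case_prod_unfold intro!: continuous_intros)
    then show "continuous_map ?X (top_of_set (sphere 0 1))
        (\<lambda>w. snd ((\<lambda>(x, y). x \<otimes>\<^bsub>bohr_group\<^esub> y) w) \<theta>)"
      unfolding continuous_map_in_subtopology
      using sph by (auto simp: o_def case_prod_unfold bohr_group_def norm_mult)
  qed
  have "continuous_map bohr_group_top bohr_group_top
      (\<lambda>x :: ((real ^ 'n) \<times> (real ^ 'n \<Rightarrow> complex)). (- fst x, \<lambda>\<theta>. cnj (snd x \<theta>)))"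
    unfolding continuous_map_bohr_group_top_iff
  proof (intro conjI allI)
    have "continuous_map bohr_group_top euclidean (uminus \<circ> (fst :: ((real ^ 'n) \<times> (real ^ 'n \<Rightarrow> complex)) \<Rightarrow> _))"
      by (rule continuous_map_compose[OF v]) (auto intro!: continuous_intros)
    then show "continuous_map bohr_group_top euclidean
      (\<lambda>x :: ((real ^ 'n) \<times> (real ^ 'n \<Rightarrow> complex)). fst (- fst x, \<lambda>\<theta>. cnj (snd x \<theta>)))"
      by (simp add: o_def)
    fix \<theta> :: "real ^ 'n"
    have "continuous_map bohr_group_top euclidean (cnj \<circ> (\<lambda>x. snd x \<theta>))"
      by (rule continuous_map_compose[OF z']) (auto intro!: continuous_intros)
    then show "continuous_map bohr_group_top (top_of_set (sphere 0 1))
        (\<lambda>x. snd (- fst x, \<lambda>\<theta>. cnj (snd x \<theta>)) \<theta>)"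
      unfolding continuous_map_in_subtopology using sph by (auto simp: o_def)
  qed
  then have inv: "continuous_map bohr_group_top bohr_group_top
      (\<lambda>x :: ((real ^ 'n) \<times> (real ^ 'n \<Rightarrow> complex)). inv\<^bsub>bohr_group\<^esub> x)"
    by (rule continuous_map_eq) (simp add: topspace_bohr_group_top inv_bohr_group)
  have "compact_space (product_topology (\<lambda>_ :: real ^ 'n. top_of_set (sphere 0 1 :: complex set)) UNIV)"
    by (simp add: compact_space_product_topology compact_space_subtopology)
  then have "locally_compact_space (bohr_group_top :: ((real ^ 'n) \<times> (real ^ 'n \<Rightarrow> complex)) topology)"
    unfolding bohr_group_top_def
    by (simp add: locally_compact_space_prod_topology compact_imp_locally_compact_space
        locally_compact_space_euclidean)
  moreover have "Hausdorff_space (bohr_group_top :: ((real ^ 'n) \<times> (real ^ 'n \<Rightarrow> complex)) topology)"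
    unfolding bohr_group_top_def
    by (simp add: Hausdorff_space_prod_topology Hausdorff_space_product_topology Hausdorff_space_subtopology)
  ultimately show ?thesis
    using mult inv group_bohr_group
    by (simp add: locally_compact_group_def topological_group_def topspace_bohr_group_top)
qed

definition bohr_embed :: "(real ^ 'n) set \<Rightarrow> int ^ 'n \<Rightarrow> ((real ^ 'n) \<times> (real ^ 'n \<Rightarrow> complex))" where
  "bohr_embed L m = (orth_proj L (rvec m), \<lambda>\<theta>. character \<theta> m)"

definition bohr_topology :: "(real ^ 'n) set \<Rightarrow> (int ^ 'n) topology" where
  "bohr_topology L = pullback_topology UNIV (bohr_embed L) bohr_group_top"

lemma topological_group_bohr: "topological_group (bohr_group :: ((real ^ 'n) \<times> (real ^ 'n \<Rightarrow> complex)) monoid) bohr_group_top"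
  by (rule locally_compact_group_bohr[unfolded locally_compact_group_def, THEN conjunct1])

lemma bohr_embed_in: "bohr_embed L m \<in> carrier bohr_group"
  by (simp add: bohr_embed_def bohr_group_def)

lemma bohr_embed_add:
  assumes "subspace L"
  shows "bohr_embed L (a + b) = bohr_embed L a \<otimes>\<^bsub>bohr_group\<^esub> bohr_embed L b"
  using linear_orth_proj[OF assms]
  by (simp add: bohr_embed_def bohr_group_def rvec_add linear_add character_add)

lemma group_topology_bohr: "subspace L \<Longrightarrow> group_topology (bohr_topology L)"
  unfolding bohr_topology_def
  by (intro group_topology_pullback[OF topological_group_bohr] bohr_embed_in bohr_embed_add)

lemma continuous_map_bohr_embed_iff:
  "continuous_map X bohr_group_top (bohr_embed L) \<longleftrightarrow>
     continuous_map X euclidean (\<lambda>m. orth_proj L (rvec m)) \<and> (\<forall>\<theta>. continuous_map X euclidean (character \<theta>))"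
  by (auto simp: continuous_map_bohr_group_top_iff bohr_embed_def continuous_map_in_subtopology)

lemma
  shows continuous_map_bohr_embed: "continuous_map (bohr_topology L) bohr_group_top (bohr_embed L)"
    and continuous_map_bohr_proj: "continuous_map (bohr_topology L) euclidean (\<lambda>m. orth_proj L (rvec m))"
    and continuous_map_bohr_character: "continuous_map (bohr_topology L) euclidean (character \<theta>)"
proof -
  show *: "continuous_map (bohr_topology L) bohr_group_top (bohr_embed L)"
    using continuous_map_pullback[OF continuous_map_id, of UNIV "bohr_embed L" bohr_group_top]
    by (simp add: bohr_topology_def)
  show "continuous_map (bohr_topology L) euclidean (\<lambda>m. orth_proj L (rvec m))"
    "continuous_map (bohr_topology L) euclidean (character \<theta>)"
    using * unfolding continuous_map_bohr_embed_iff by auto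
qed

lemma coarser_bohr_iff:
  "topspace \<sigma> = UNIV \<Longrightarrow> coarser (bohr_topology L) \<sigma> \<longleftrightarrow> continuous_map \<sigma> bohr_group_top (bohr_embed L)"
  unfolding bohr_topology_def
  by (rule coarser_pullback_iff) (auto simp: topspace_bohr_group_top bohr_embed_in)

lemma topspace_bohr_topology: "topspace (bohr_topology L) = UNIV"
  using bohr_embed_in by (auto simp: bohr_topology_def topspace_pullback_topology topspace_bohr_group_top)

lemma compactin_bohr_group: "compactin (bohr_group_top :: ((real ^ 'n) \<times> (real ^ 'n \<Rightarrow> complex)) topology) (cball 0 R \<times> {z. \<forall>\<theta>. norm (z \<theta>) = 1})"
proof -
  have "{z :: real ^ 'n \<Rightarrow> complex. \<forall>\<theta>. norm (z \<theta>) = 1} = topspace (product_topology (\<lambda>_. top_of_set (sphere 0 1)) UNIV)"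
    by (auto simp: PiE_iff)
  moreover have "compact_space (product_topology (\<lambda>_ :: real ^ 'n. top_of_set (sphere 0 1 :: complex set)) UNIV)"
    by (simp add: compact_space_product_topology compact_space_subtopology)
  ultimately have "compactin (product_topology (\<lambda>_. top_of_set (sphere 0 1)) UNIV)
      {z :: real ^ 'n \<Rightarrow> complex. \<forall>\<theta>. norm (z \<theta>) = 1}"
    by (simp only: compact_space_def)
  then show ?thesis by (simp add: bohr_group_top_def compactin_Times)
qed

text \<open>The strip is the preimage of a ball times all circles, a compact set by Tychonoff's
  theorem.\<close>

lemma precompact_bohr_strip:
  assumes "subspace L"
  shows "precompact (bohr_topology L) {m. norm (orth_proj L (rvec m)) \<le> R}"
proof -
  have "precompact (bohr_topology L) {m. bohr_embed L m \<in> cball 0 R \<times> {z. \<forall>\<theta>. norm (z \<theta>) = 1}}"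
    unfolding bohr_topology_def
    by (intro precompact_preimage[OF topological_group_bohr] bohr_embed_in bohr_embed_add assms
        compactin_bohr_group)
  then show ?thesis by (simp add: bohr_embed_def)
qed

text \<open>Every homomorphism to the reals is an inner product with some \<open>l\<close>, and by
  \<open>small_near_0\<close> boundedness near \<open>0\<close> is continuity. So for a group
  topology this is the space of its continuous homomorphisms to the reals.\<close>

definition bounded_functionals :: "(int ^ 'n) topology \<Rightarrow> (real ^ 'n) set" where
  "bounded_functionals \<tau> = {l. \<exists>U. openin \<tau> U \<and> 0 \<in> U \<and> bounded ((\<lambda>m. rvec m \<bullet> l) ` U)}"

lemma bounded_functional_on_precompact:
  assumes "l \<in> bounded_functionals \<tau>" "precompact \<tau> S"
  shows "bounded ((\<lambda>m. rvec m \<bullet> l) ` S)"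
proof -
  obtain U where "openin \<tau> U" "0 \<in> U" "bounded ((\<lambda>m. rvec m \<bullet> l) ` U)"
    using assms(1) by (auto simp: bounded_functionals_def)
  then show ?thesis
    by (intro bounded_on_precompact[OF _ assms(2)]) (auto simp: rvec_add inner_add_left)
qed

lemma subspace_bounded_functionals:
  assumes "topspace \<tau> = UNIV"
  shows "subspace (bounded_functionals \<tau>)"
proof (rule subspaceI)
  show "0 \<in> bounded_functionals \<tau>"
    using openin_topspace[of \<tau>] assms by (auto simp: bounded_functionals_def intro!: exI[of _ UNIV])
next
  fix l c assume "l \<in> bounded_functionals \<tau>"
  then obtain U where U: "openin \<tau> U" "0 \<in> U" "bounded ((\<lambda>m. rvec m \<bullet> l) ` U)"
    by (auto simp: bounded_functionals_def)
  have "bounded ((\<lambda>m. rvec m \<bullet> (c *\<^sub>R l)) ` U)"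
    using bounded_scaling[OF U(3), of c] by (simp add: image_image)
  then show "c *\<^sub>R l \<in> bounded_functionals \<tau>" using U(1,2) unfolding bounded_functionals_def by blast
next
  fix l k assume "l \<in> bounded_functionals \<tau>" "k \<in> bounded_functionals \<tau>"
  then obtain U V where U: "openin \<tau> U" "0 \<in> U" "bounded ((\<lambda>m. rvec m \<bullet> l) ` U)"
    and V: "openin \<tau> V" "0 \<in> V" "bounded ((\<lambda>m. rvec m \<bullet> k) ` V)"
    by (auto simp: bounded_functionals_def)
  have "bounded ((\<lambda>m. rvec m \<bullet> l) ` (U \<inter> V))" "bounded ((\<lambda>m. rvec m \<bullet> k) ` (U \<inter> V))"
    by (rule bounded_subset[OF U(3)], blast) (rule bounded_subset[OF V(3)], blast)
  then have "bounded ((\<lambda>m. rvec m \<bullet> (l + k)) ` (U \<inter> V))"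
    by (simp add: inner_add_right bounded_plus_comp)
  then show "l + k \<in> bounded_functionals \<tau>"
    using openin_Int[OF U(1) V(1)] U(2) V(2) unfolding bounded_functionals_def by blast
qed

lemma bounded_functionals_mono:
  "coarser \<tau> \<tau>' \<Longrightarrow> bounded_functionals \<tau> \<subseteq> bounded_functionals \<tau>'"
  by (auto simp: coarser_def bounded_functionals_def)

text \<open>If \<open>l \<notin> L\<close>, then the integer points nearest to the multiples of the component of \<open>l\<close> orthogonal
  to \<open>L\<close> form a precompact set on which \<open>l\<close> is unbounded.\<close>

lemma bounded_functionals_bohr:
  fixes L :: "(real ^ 'n) set"
  assumes L: "subspace L"
  shows "bounded_functionals (bohr_topology L) = L"
proof (intro equalityI subsetI)
  fix l assume l: "l \<in> L"
  have "openin (bohr_topology L) {m \<in> topspace (bohr_topology L). orth_proj L (rvec m) \<in> ball 0 1}"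
    by (rule openin_continuous_map_preimage[OF continuous_map_bohr_proj]) simp
  moreover have "0 \<in> {m \<in> topspace (bohr_topology L). orth_proj L (rvec m) \<in> ball 0 1}"
    using linear_0[OF linear_orth_proj[OF L]] by (simp add: topspace_bohr_topology)
  moreover have "norm (rvec m \<bullet> l) \<le> norm l" if "norm (orth_proj L (rvec m)) < 1" for m
  proof -
    have "\<bar>orth_proj L (rvec m) \<bullet> l\<bar> \<le> norm (orth_proj L (rvec m)) * norm l"
      by (rule Cauchy_Schwarz_ineq2)
    also have "\<dots> \<le> norm l" using that by (simp add: mult_left_le_one_le less_imp_le)
    finally show ?thesis by (simp add: inner_orth_proj[OF L l])
  qed
  then have "bounded ((\<lambda>m. rvec m \<bullet> l) ` {m \<in> topspace (bohr_topology L). orth_proj L (rvec m) \<in> ball 0 1})"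
    unfolding bounded_iff by (intro exI[of _ "norm l"]) auto
  ultimately show "l \<in> bounded_functionals (bohr_topology L)"
    unfolding bounded_functionals_def by blast
next
  fix l assume l: "l \<in> bounded_functionals (bohr_topology L)"
  define k where "k = l - orth_proj L l"
  have lin: "linear (orth_proj L)" by (rule linear_orth_proj[OF L])
  have pk: "orth_proj L k = 0"
    using lin orth_proj_of_mem[OF L orth_proj_in[OF L, of l]] by (simp add: k_def linear_diff)
  define C where "C = (real CARD('n))"
  define m where "m t = (\<chi> i. round (real t * k $ i))" for t :: nat
  have m: "norm (rvec (m t) - real t *\<^sub>R k) \<le> C" for t
  proof -
    have "norm (rvec (m t) - real t *\<^sub>R k) \<le> (\<Sum>i\<in>UNIV. \<bar>(rvec (m t) - real t *\<^sub>R k) $ i\<bar>)"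
      by (rule norm_le_l1_cart)
    also have "\<dots> \<le> (\<Sum>i\<in>(UNIV :: 'n set). 1)"
      by (intro sum_mono) (use of_int_round_abs_le[of "real t * k $ _"] in
          \<open>simp add: m_def order_trans[of _ "1/2" 1]\<close>)
    finally show ?thesis by (simp add: C_def)
  qed
  obtain K where K: "0 < K" "\<And>x. norm (orth_proj L x) \<le> K * norm x"
    using linear_bounded_pos[OF lin] by blast
  have "norm (orth_proj L (rvec (m t))) \<le> K * C" for t
  proof -
    have "orth_proj L (rvec (m t)) = orth_proj L (rvec (m t) - real t *\<^sub>R k)"
      using lin pk by (simp add: linear_diff linear_scale)
    also have "norm \<dots> \<le> K * norm (rvec (m t) - real t *\<^sub>R k)" by (rule K(2))
    also have "\<dots> \<le> K * C" using m[of t] K(1) by simp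
    finally show ?thesis .
  qed
  then have "bounded ((\<lambda>m. rvec m \<bullet> l) ` range m)"
    by (intro bounded_functional_on_precompact[OF l] precompact_subset[OF precompact_bohr_strip[OF L, of "K * C"]]) auto
  then obtain D where D: "\<And>t. \<bar>rvec (m t) \<bullet> l\<bar> \<le> D" unfolding bounded_iff by auto
  \<comment> \<open>Up to a bounded error \<open>rvec (m t) \<bullet> l\<close> equals
    \<open>t * (k \<bullet> k)\<close>, but it stays bounded as \<open>t\<close> grows; this forces
    \<open>k = 0\<close>.\<close>
  have "k \<bullet> k \<le> (D + C * norm l) / real t" if "t > 0" for t
  proof -
    have "k \<bullet> l = k \<bullet> k"
      using inner_orth_proj_orthogonal[OF L pk, of l] by (simp add: k_def inner_diff_right)
    then have "real t * (k \<bullet> k) = rvec (m t) \<bullet> l - (rvec (m t) - real t *\<^sub>R k) \<bullet> l"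
      by (simp add: inner_diff_left)
    also have "\<dots> \<le> D + C * norm l"
      using D[of t] Cauchy_Schwarz_ineq2[of "rvec (m t) - real t *\<^sub>R k" l]
        mult_right_mono[OF m[of t] norm_ge_zero[of l]] by (simp add: abs_le_iff)
    finally show ?thesis using that by (simp add: field_simps)
  qed
  then have "\<forall>\<^sub>F t in sequentially. k \<bullet> k \<le> (D + C * norm l) / real t"
    using eventually_gt_at_top[of 0] by (rule eventually_mono[rotated])
  then have "k \<bullet> k \<le> 0"
    by (rule tendsto_le[OF sequentially_bot lim_const_over_n tendsto_const])
  then have "k = 0" by (metis inner_eq_zero_iff inner_ge_zero order_antisym)
  then have "l = orth_proj L l" by (simp add: k_def)
  then show "l \<in> L" using orth_proj_in[OF L, of l] by simp
qed

text \<open>Projecting to a smaller space factors through projecting to the sum, which gives one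
  inclusion. For the other, the projection to the sum must be recovered continuously from the two
  given ones; it is not their sum unless the spaces are orthogonal, so an orthonormal basis is split
  into parts from both spaces.\<close>

lemma topology_join_bohr:
  fixes L\<^sub>1 L\<^sub>2 :: "(real ^ 'n) set"
  assumes L: "subspace L\<^sub>1" "subspace L\<^sub>2"
  shows "topology_join (bohr_topology L\<^sub>1) (bohr_topology L\<^sub>2) = bohr_topology (subspace_sum L\<^sub>1 L\<^sub>2)"
    (is "?J = bohr_topology ?L")
proof (rule coarser_antisym)
  have L12: "subspace ?L" unfolding subspace_sum_def by (rule subspace_sums[OF L])
  have sub: "L\<^sub>1 \<subseteq> ?L" "L\<^sub>2 \<subseteq> ?L"
    using subspace_0[OF L(1)] subspace_0[OF L(2)] by (force simp: subspace_sum_def)+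
  have mono: "coarser (bohr_topology M) (bohr_topology ?L)" if M: "subspace M" "M \<subseteq> ?L" for M
  proof -
    have "orth_proj M (rvec m) = orth_proj M (orth_proj ?L (rvec m))" for m
      using M orth_proj_in[OF M(1)] inner_orth_proj[OF M(1)] inner_orth_proj[OF L12]
      by (intro orth_proj_eq[OF M(1)]) auto
    moreover have "continuous_map (bohr_topology ?L) euclidean (orth_proj M \<circ> (\<lambda>m. orth_proj ?L (rvec m)))"
      using linear_orth_proj[OF M(1)]
      by (intro continuous_map_compose[OF continuous_map_bohr_proj])
        (simp add: linear_continuous_on linear_conv_bounded_linear)
    ultimately show ?thesis
      by (simp add: coarser_bohr_iff topspace_bohr_topology continuous_map_bohr_embed_iff
          continuous_map_bohr_character o_def)
  qed
  show "coarser ?J (bohr_topology ?L)"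
    using mono L sub by (intro topology_join_coarsest) auto
  have top: "topspace ?J = UNIV"
    using topology_join_coarsest(1)[of "bohr_topology L\<^sub>1" "bohr_topology L\<^sub>2"]
    by (metis (mono_tags) coarser_def mem_Collect_eq openin_topspace openin_subset subsetD
        top.extremum_uniqueI topspace_bohr_topology)
  have J: "continuous_map ?J bohr_group_top (bohr_embed L\<^sub>1)" "continuous_map ?J bohr_group_top (bohr_embed L\<^sub>2)"
    using topology_join_coarsest(1,2) by (auto simp flip: coarser_bohr_iff[OF top])
  obtain B where B: "B \<subseteq> ?L" "pairwise orthogonal B" "\<And>x. x \<in> B \<Longrightarrow> norm x = 1"
    "independent B" "span B = ?L"
    using orthonormal_basis_subspace[OF L12] by metis
  have fin: "finite B" using B(4) independent_imp_finite by blast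
  have "\<forall>b\<in>B. \<exists>x y. x \<in> L\<^sub>1 \<and> y \<in> L\<^sub>2 \<and> b = x + y" using B(1) unfolding subspace_sum_def by blast
  then obtain f g where fg: "\<And>b. b \<in> B \<Longrightarrow> f b \<in> L\<^sub>1 \<and> g b \<in> L\<^sub>2 \<and> b = f b + g b" by metis
  \<comment> \<open>Any splitting \<open>b = f b + g b\<close> will do, since the coefficient along
    \<open>b\<close> is the sum of the two inner products.\<close>
  define G where "G = (\<lambda>(u, v). \<Sum>b\<in>B. (u \<bullet> f b + v \<bullet> g b) *\<^sub>R b)"
  have "orth_proj ?L (rvec m) = G (orth_proj L\<^sub>1 (rvec m), orth_proj L\<^sub>2 (rvec m))" for m
  proof -
    have "orth_proj ?L (rvec m) = (\<Sum>b\<in>B. (orth_proj ?L (rvec m) \<bullet> b) *\<^sub>R b)"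
      using orthonormal_basis_expand[of B "orth_proj ?L (rvec m)"] orth_proj_in[OF L12] B fin by simp
    also have "\<dots> = G (orth_proj L\<^sub>1 (rvec m), orth_proj L\<^sub>2 (rvec m))"
      unfolding G_def prod.case
    proof (rule sum.cong[OF refl])
      fix b assume b: "b \<in> B"
      have "orth_proj ?L (rvec m) \<bullet> b = rvec m \<bullet> f b + rvec m \<bullet> g b"
        using fg[OF b] inner_orth_proj[OF L12] B(1) b by (metis inner_add_right subsetD)
      then show "(orth_proj ?L (rvec m) \<bullet> b) *\<^sub>R b
          = (orth_proj L\<^sub>1 (rvec m) \<bullet> f b + orth_proj L\<^sub>2 (rvec m) \<bullet> g b) *\<^sub>R b"
        using fg[OF b] by (simp add: inner_orth_proj[OF L(1)] inner_orth_proj[OF L(2)])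
    qed
    finally show ?thesis .
  qed
  moreover have "continuous_map ?J euclidean (G \<circ> (\<lambda>m. (orth_proj L\<^sub>1 (rvec m), orth_proj L\<^sub>2 (rvec m))))"
  proof (rule continuous_map_compose)
    show "continuous_map ?J (prod_topology euclidean euclidean) (\<lambda>m. (orth_proj L\<^sub>1 (rvec m), orth_proj L\<^sub>2 (rvec m)))"
      using J unfolding continuous_map_paired continuous_map_bohr_embed_iff by blast
    show "continuous_map (prod_topology euclidean euclidean) euclidean G"
      by (auto simp: G_def case_prod_unfold intro!: continuous_intros)
  qed
  ultimately show "coarser (bohr_topology ?L) ?J"
    using J(1) by (simp add: coarser_bohr_iff[OF top] continuous_map_bohr_embed_iff o_def)
qed

section \<open>Classification of the topologies that are not proper quotients\<close>

lemma openin_finite_Ball: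
  assumes "finite I" "topspace \<tau> = UNIV" "\<And>i. i \<in> I \<Longrightarrow> openin \<tau> {x. P i x}"
  shows "openin \<tau> {x. \<forall>i\<in>I. P i x}"
  using assms(1,3)
proof (induction I)
  case empty
  then show ?case using openin_topspace[of \<tau>] assms(2) by simp
next
  case (insert i I)
  then have "openin \<tau> ({x. P i x} \<inter> {x. \<forall>i\<in>I. P i x})" by (intro openin_Int) auto
  moreover have "{x. P i x} \<inter> {x. \<forall>i\<in>I. P i x} = {x. \<forall>j\<in>insert i I. P j x}" by auto
  ultimately show ?case by simp
qed

text \<open>Adding to a small neighbourhood a subgroup \<open>\<Lambda>\<close> that projects onto a lattice of \<open>L\<close> makes it
  syndetic, so that Bogolyubov's theorem applies; the contribution of \<open>\<Lambda>\<close> is removed again by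
  restricting to points with small projection to \<open>L\<close>.\<close>

theorem coarser_bohr_bounded_functionals:
  fixes \<tau> :: "(int ^ 'n) topology"
  assumes \<tau>: "group_topology \<tau>" and U0: "openin \<tau> U0" "0 \<in> U0" "precompact \<tau> U0"
  shows "coarser \<tau> (bohr_topology (bounded_functionals \<tau>))"
proof -
  define L where "L = bounded_functionals \<tau>"
  have L: "subspace L"
    unfolding L_def by (rule subspace_bounded_functionals[OF group_topology_topspace[OF \<tau>]])
  define p where "p m = orth_proj L (rvec m)" for m :: "int ^ 'n"
  have lin: "linear (orth_proj L)" by (rule linear_orth_proj[OF L])
  have p_add: "p (x + y) = p x + p y" and p_diff: "p (x - y) = p x - p y" for x y
    using lin by (simp_all add: p_def rvec_add rvec_diff linear_add linear_diff)
  \<comment> \<open>Symmetrised because \<open>approximate_group_near\<close> asks for closure under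
    negation.\<close>
  define A where "A = U0 \<union> uminus ` U0"
  have preA: "precompact \<tau> A"
    unfolding A_def by (intro precompact_Un U0(3) precompact_uminus[OF \<tau>])
  have L_eq: "L = {l. bounded ((\<lambda>a. a \<bullet> l) ` rvec ` A)}"
  proof (intro equalityI subsetI CollectI)
    fix l assume "l \<in> L"
    then show "bounded ((\<lambda>a. a \<bullet> l) ` rvec ` A)"
      using bounded_functional_on_precompact[OF _ preA] by (simp add: L_def image_image)
  next
    fix l assume "l \<in> {l. bounded ((\<lambda>a. a \<bullet> l) ` rvec ` A)}"
    then have "bounded ((\<lambda>m. rvec m \<bullet> l) ` A)" by (simp add: image_image)
    then have "bounded ((\<lambda>m. rvec m \<bullet> l) ` U0)"
      by (rule bounded_subset) (auto simp: A_def)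
    then show "l \<in> L" using U0 unfolding L_def bounded_functionals_def by blast
  qed
  \<comment> \<open>Sums of two elements of \<open>A\<close> form a precompact set, hence return to
    \<open>U0\<close> up to the finite set \<open>F\<close>; this is the approximate closure under
    addition.\<close>
  obtain F where F: "finite F"
    "\<And>s. s \<in> {s + t | s t. s \<in> A \<and> t \<in> A} \<Longrightarrow> \<exists>f\<in>F. s - f \<in> U0"
    by (rule precompactD[OF precompact_add[OF \<tau> preA preA] U0(1,2)]) blast
  obtain C where C: "\<And>f. f \<in> F \<Longrightarrow> norm (rvec f) \<le> C"
    using finite_imp_bounded[OF finite_imageI[OF F(1)], of rvec] unfolding bounded_iff by auto
  have near: "\<exists>R'. \<forall>m. norm (orth_proj L m) \<le> R \<longrightarrow> (\<exists>x\<in>rvec ` A. norm (m - x) \<le> R')" for R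
  proof (rule approximate_group_near[OF L L_eq, of C R])
    show "rvec ` A \<noteq> {}" using U0(2) by (auto simp: A_def)
    show "- a \<in> rvec ` A" if "a \<in> rvec ` A" for a
      using that by (auto simp: A_def simp flip: rvec_minus)
    fix a b assume "a \<in> rvec ` A" "b \<in> rvec ` A"
    then obtain x y where xy: "x \<in> A" "y \<in> A" "a = rvec x" "b = rvec y" by blast
    then obtain f where f: "f \<in> F" "x + y - f \<in> U0" using F(2)[of "x + y"] by blast
    then have "rvec (x + y - f) \<in> rvec ` A" by (auto simp: A_def)
    moreover have "norm (a + b - rvec (x + y - f)) \<le> C"
      using C[OF f(1)] by (simp add: xy rvec_add rvec_diff)
    ultimately show "\<exists>c\<in>rvec ` A. norm (a + b - c) \<le> C" by blast
  qed blast
  \<comment> \<open>Points of the strip are within bounded distance of \<open>A\<close>, and only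
    finitely many integer vectors have bounded length, so the strip lies in a finite set plus
    \<open>A\<close>.\<close>
  have strip: "precompact \<tau> {m. norm (p m) \<le> R}" for R
  proof -
    obtain R' where R': "\<And>m. norm (orth_proj L m) \<le> R \<Longrightarrow> \<exists>x\<in>rvec ` A. norm (m - x) \<le> R'"
      using near[of R] by blast
    have "{m. norm (p m) \<le> R} \<subseteq> {s + t | s t. s \<in> {m. norm (rvec m) \<le> R'} \<and> t \<in> A}"
    proof
      fix m assume "m \<in> {m. norm (p m) \<le> R}"
      then obtain a where "a \<in> A" "norm (rvec m - rvec a) \<le> R'" using R'[of "rvec m"] by (auto simp: p_def)
      then have "m = (m - a) + a" "m - a \<in> {m. norm (rvec m) \<le> R'}" by (simp_all add: rvec_diff)
      then show "m \<in> {s + t | s t. s \<in> {m. norm (rvec m) \<le> R'} \<and> t \<in> A}"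
        using \<open>a \<in> A\<close> by blast
    qed
    then show ?thesis
      using precompact_add[OF \<tau> precompact_finite[OF finite_rvec_bounded] preA] precompact_subset by blast
  qed
  obtain \<Lambda> :: "(int ^ 'n) set" and c R where c: "0 < c"
    and \<Lambda>_diff: "\<And>x y. x \<in> \<Lambda> \<Longrightarrow> y \<in> \<Lambda> \<Longrightarrow> x - y \<in> \<Lambda>" and \<Lambda>_0: "0 \<in> \<Lambda>"
    and \<Lambda>_small: "\<And>x. x \<in> \<Lambda> \<Longrightarrow> norm (p x) < c \<Longrightarrow> x = 0"
    and \<Lambda>_cover: "\<And>m. \<exists>x\<in>\<Lambda>. norm (p (m - x)) \<le> R"
    unfolding p_def by (rule lattice_complement[OF lin]) blast
  have \<Lambda>_add: "x + y \<in> \<Lambda>" if "x \<in> \<Lambda>" "y \<in> \<Lambda>" for x y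
    using \<Lambda>_diff[OF that(1) \<Lambda>_diff[OF \<Lambda>_0 that(2)]] by simp
  have "bounded (orth_proj L ` rvec ` U0)"
    by (rule bounded_orth_proj_image[OF L])
      (use bounded_functional_on_precompact[OF _ U0(3)] in \<open>simp add: L_def image_image\<close>)
  then have bdd: "bounded (p ` U0)" by (simp add: p_def[abs_def] image_image)
  have "group_topology (bohr_topology L)" by (rule group_topology_bohr[OF L])
  then have "coarser \<tau> (bohr_topology L)"
  proof (rule coarser_group_topologyI[OF \<tau>])
    fix U assume U: "openin \<tau> U" "0 \<in> U"
    obtain V1 where V1: "openin \<tau> V1" "0 \<in> V1" "\<And>x y. x \<in> V1 \<Longrightarrow> y \<in> V1 \<Longrightarrow> x - y \<in> U"
      using group_topology_diff[OF \<tau> U] by metis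
    obtain V2 where V2: "openin \<tau> V2" "0 \<in> V2" "\<And>x y. x \<in> V2 \<Longrightarrow> y \<in> V2 \<Longrightarrow> x + y \<in> V1"
      using group_topology_add[OF \<tau> V1(1,2)] by metis
    \<comment> \<open>The factor \<open>5\<close> accounts for \<open>m\<close> and four elements of
      \<open>V\<close>, whose projections are added up below.\<close>
    obtain V3 where V3: "openin \<tau> V3" "0 \<in> V3" "\<And>x. x \<in> V3 \<Longrightarrow> norm (p x) < c / 5"
      using small_near_0[where f = p, OF \<tau> p_add U0(1,2) bdd, of "c / 5"] c by auto
    define V where "V = V2 \<inter> V3"
    have V: "openin \<tau> V" "0 \<in> V" using V2 V3 by (auto simp: V_def)
    obtain T where T: "finite T" "\<And>s. s \<in> {m. norm (p m) \<le> R} \<Longrightarrow> \<exists>f\<in>T. s - f \<in> V"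
      by (rule precompactD[OF strip V]) blast
    define B where "B = {x + v | x v. x \<in> \<Lambda> \<and> v \<in> V}"
    \<comment> \<open>Subtracting an element of \<open>\<Lambda>\<close> moves \<open>m\<close> into
      a strip, which is \<open>\<tau>\<close>-precompact and so covered by finitely many translates
      of \<open>V\<close>.\<close>
    have cover: "\<exists>t\<in>T. m - t \<in> B" for m
    proof -
      obtain x where x: "x \<in> \<Lambda>" "norm (p (m - x)) \<le> R" using \<Lambda>_cover by blast
      then obtain t where t: "t \<in> T" "m - x - t \<in> V" using T(2) by blast
      have "m - t = x + (m - x - t)" by simp
      then show ?thesis using x(1) t unfolding B_def by blast
    qed
    obtain \<Theta> where \<Theta>: "finite \<Theta>" "\<And>m. (\<And>\<theta>. \<theta> \<in> \<Theta> \<Longrightarrow> 0 < Re (character \<theta> m)) \<Longrightarrow>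
        \<exists>a\<in>B. \<exists>b\<in>B. \<exists>c\<in>B. \<exists>d\<in>B. m = a + b - c - d"
      by (rule bogolyubov[OF T(1) cover]) blast
    define N where "N = {m. norm (p m) < c / 5} \<inter> {m. \<forall>\<theta>\<in>\<Theta>. 0 < Re (character \<theta> m)}"
    have "openin (bohr_topology L) {m. norm (p m) < c / 5}"
      using openin_continuous_map_preimage[OF continuous_map_bohr_proj, of "ball 0 (c / 5)" L]
      by (simp add: topspace_bohr_topology p_def)
    moreover have "openin (bohr_topology L) {m. 0 < Re (character \<theta> m)}" for \<theta>
      using openin_continuous_map_preimage[OF continuous_map_bohr_character, of "{z. 0 < Re z}" L \<theta>]
      by (simp add: topspace_bohr_topology open_halfspace_Re_gt)
    ultimately have "openin (bohr_topology L) N"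
      unfolding N_def by (intro openin_Int openin_finite_Ball \<Theta>(1) topspace_bohr_topology)
    moreover have "0 \<in> N" using c linear_0[OF lin] by (simp add: N_def p_def)
    moreover have "N \<subseteq> U"
    proof
      fix m assume m: "m \<in> N"
      then have "\<exists>a\<in>B. \<exists>b\<in>B. \<exists>c\<in>B. \<exists>d\<in>B. m = a + b - c - d"
        by (intro \<Theta>(2)) (simp add: N_def)
      then obtain x1 x2 x3 x4 v1 v2 v3 v4 where x: "x1 \<in> \<Lambda>" "x2 \<in> \<Lambda>" "x3 \<in> \<Lambda>" "x4 \<in> \<Lambda>"
        and v: "v1 \<in> V" "v2 \<in> V" "v3 \<in> V" "v4 \<in> V"
        and m_eq: "m = (x1 + v1) + (x2 + v2) - (x3 + v3) - (x4 + v4)"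
        unfolding B_def by blast
      \<comment> \<open>The total contribution of \<open>\<Lambda>\<close> is \<open>m\<close>
        corrected by elements of \<open>V\<close>, so its projection is shorter than
        \<open>c\<close> and it vanishes.\<close>
      define x where "x = x1 + x2 - x3 - x4"
      have xm: "x = m - v1 - v2 + v3 + v4" by (simp add: x_def m_eq)
      have "norm (p x) \<le> norm (p m) + norm (p v1) + norm (p v2) + norm (p v3) + norm (p v4)"
        unfolding xm p_add p_diff by norm
      also have "\<dots> < c"
        using m V3(3)[of v1] V3(3)[of v2] V3(3)[of v3] V3(3)[of v4] v by (simp add: N_def V_def)
      finally have "x = 0" using x unfolding x_def by (intro \<Lambda>_small \<Lambda>_diff \<Lambda>_add)
      then have "m = (v1 + v2) - (v3 + v4)" by (simp add: m_eq x_def algebra_simps)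
      then show "m \<in> U" using V1(3)[OF V2(3) V2(3)] v by (simp add: V_def)
    qed
    ultimately show "\<exists>V. openin (bohr_topology L) V \<and> 0 \<in> V \<and> V \<subseteq> U" by blast
  qed
  then show ?thesis by (simp add: L_def)
qed

section \<open>Neighbourhoods of compact sets, products and change of carrier type\<close>

lemma locally_compact_space_compact_nbhd:
  assumes X: "locally_compact_space X" and K: "compactin X K"
  obtains W K' where "openin X W" "compactin X K'" "K \<subseteq> W" "W \<subseteq> K'"
proof -
  have "\<forall>x\<in>topspace X. \<exists>U K. openin X U \<and> compactin X K \<and> x \<in> U \<and> U \<subseteq> K"
    using X by (simp add: locally_compact_space_def)
  then obtain U C where UC: "\<And>x. x \<in> topspace X \<Longrightarrow> openin X (U x) \<and> compactin X (C x) \<and> x \<in> U x \<and> U x \<subseteq> C x"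
    by metis
  have KX: "K \<subseteq> topspace X" by (rule compactin_subset_topspace[OF K])
  have "(\<forall>V\<in>U ` K. openin X V) \<and> K \<subseteq> \<Union> (U ` K)" using UC KX by blast
  then obtain \<F> where "finite \<F>" "\<F> \<subseteq> U ` K" "K \<subseteq> \<Union>\<F>"
    using K unfolding compactin_def by meson
  then obtain I where I: "finite I" "I \<subseteq> K" "K \<subseteq> \<Union> (U ` I)"
    by (metis finite_subset_image)
  show thesis
  proof (rule that[of "\<Union> (U ` I)" "\<Union> (C ` I)"])
    show "openin X (\<Union> (U ` I))" using UC I(2) KX by (intro openin_Union) blast
    show "compactin X (\<Union> (C ` I))"
      using UC I(1,2) KX by (intro compactin_Union) auto
    show "\<Union> (U ` I) \<subseteq> \<Union> (C ` I)" using UC I(2) KX by blast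
  qed (rule I(3))
qed

lemma locally_compact_group_DirProd:
  assumes G: "locally_compact_group G TG" and H: "locally_compact_group H TH"
  shows "locally_compact_group (G \<times>\<times> H) (prod_topology TG TH)"
proof -
  have gr: "group G" "group H" and sp: "topspace TG = carrier G" "topspace TH = carrier H"
    and mG: "continuous_map (prod_topology TG TG) TG (\<lambda>(x, y). x \<otimes>\<^bsub>G\<^esub> y)"
    and mH: "continuous_map (prod_topology TH TH) TH (\<lambda>(x, y). x \<otimes>\<^bsub>H\<^esub> y)"
    and iG: "continuous_map TG TG (\<lambda>x. inv\<^bsub>G\<^esub> x)" and iH: "continuous_map TH TH (\<lambda>x. inv\<^bsub>H\<^esub> x)"
    using G H by (auto simp: locally_compact_group_def topological_group_def)
  let ?P = "prod_topology TG TH"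
  have "continuous_map (prod_topology ?P ?P) (prod_topology TG TG) (\<lambda>w. (fst (fst w), fst (snd w)))"
    "continuous_map (prod_topology ?P ?P) (prod_topology TH TH) (\<lambda>w. (snd (fst w), snd (snd w)))"
    unfolding continuous_map_paired
    by (intro conjI continuous_map_compose[OF continuous_map_fst continuous_map_fst, unfolded o_def]
        continuous_map_compose[OF continuous_map_fst continuous_map_snd, unfolded o_def]
        continuous_map_compose[OF continuous_map_snd continuous_map_fst, unfolded o_def]
        continuous_map_compose[OF continuous_map_snd continuous_map_snd, unfolded o_def])+
  from continuous_map_compose[OF this(1) mG] continuous_map_compose[OF this(2) mH]
  have m: "continuous_map (prod_topology ?P ?P) ?P (\<lambda>(x, y). x \<otimes>\<^bsub>G \<times>\<times> H\<^esub> y)"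
    by (simp add: continuous_map_pairwise o_def case_prod_unfold mult_DirProd')
  have "continuous_map ?P ?P (\<lambda>(x, y). (inv\<^bsub>G\<^esub> x, inv\<^bsub>H\<^esub> y))"
    using iG iH by (simp add: continuous_map_prod_top)
  then have "continuous_map ?P ?P (\<lambda>x. inv\<^bsub>G \<times>\<times> H\<^esub> x)"
    by (rule continuous_map_eq) (use gr sp in \<open>auto simp: inv_DirProd\<close>)
  then show ?thesis
    using m G H gr sp
    by (auto simp: locally_compact_group_def topological_group_def DirProd_group
        locally_compact_space_prod_topology Hausdorff_space_prod_topology)
qed

text \<open>A point is coded by the traces on \<open>G\<close> of its neighbourhoods; this is
  injective because the target is Hausdorff and the image of \<open>G\<close> dense. In contrast to
  \<open>dense_pair_exists\<close>, the homeomorphism \<open>e\<close> is kept, as it is needed to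
  write down a connecting map.\<close>

lemma dense_pair_transport:
  fixes G :: "('a, 'm) monoid_scheme" and H :: "('b, 'k) monoid_scheme"
  assumes dp: "dense_pair G TG \<tau> H TH \<eta>"
  obtains H' :: "'a set set monoid" and TH' e where
    "dense_pair G TG \<tau> H' TH' (e \<circ> \<eta>)" "e \<in> hom H H'" "homeomorphic_map TH TH' e"
proof -
  have H: "locally_compact_group H TH" and hom: "\<eta> \<in> hom G H" and cont: "continuous_map TG TH \<eta>"
    and dense: "TH closure_of (\<eta> ` carrier G) = carrier H"
    and \<tau>: "\<tau> = pullback_topology (carrier G) \<eta> TH"
    using dp by (auto simp: dense_pair_def continuous_hom_def)
  have sp: "topspace TH = carrier H" and hd: "Hausdorff_space TH"
    using H by (auto simp: locally_compact_group_def topological_group_def)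
  have im: "\<eta> x \<in> carrier H" if "x \<in> carrier G" for x
    using hom that by (auto simp: hom_def)
  define e where "e x = {\<eta> -` U \<inter> carrier G | U. openin TH U \<and> x \<in> U}" for x
  have inj: "inj_on e (carrier H)"
  proof (rule inj_onI, rule ccontr)
    fix x y assume xy: "x \<in> carrier H" "y \<in> carrier H" "e x = e y" "x \<noteq> y"
    then obtain U V where UV: "openin TH U" "openin TH V" "x \<in> U" "y \<in> V" "disjnt U V"
      using hd unfolding Hausdorff_space_def sp by metis
    have "\<eta> -` U \<inter> carrier G \<in> e y"
      using UV xy(3)[symmetric] by (auto simp: e_def)
    then obtain W where W: "openin TH W" "y \<in> W" "\<eta> -` U \<inter> carrier G = \<eta> -` W \<inter> carrier G"
      by (auto simp: e_def)
    have "y \<in> TH closure_of (\<eta> ` carrier G)" using dense xy(2) by simp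
    moreover have "openin TH (V \<inter> W)" "y \<in> V \<inter> W" using UV W by auto
    ultimately obtain s where "s \<in> carrier G" "\<eta> s \<in> V \<inter> W"
      unfolding in_closure_of by blast
    then show False using W(3) UV(5) unfolding disjnt_def by blast
  qed
  obtain H' :: "'a set set monoid" and TH' where H': "locally_compact_group H' TH'"
    and eh: "e \<in> hom H H'" and em: "homeomorphic_map TH TH' e"
    by (rule locally_compact_group_transport[OF H inj])
  have sp': "topspace TH' = carrier H'"
    using H' by (auto simp: locally_compact_group_def topological_group_def)
  have "e \<circ> \<eta> \<in> hom G H'"
    using hom eh im by (auto simp: hom_def Pi_iff)
  then have ch: "continuous_hom G TG H' TH' (e \<circ> \<eta>)"
    using continuous_map_compose[OF cont homeomorphic_imp_continuous_map[OF em]]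
    by (simp add: continuous_hom_def)
  have pb: "\<tau> = pullback_topology (carrier G) (e \<circ> \<eta>) TH'"
    unfolding \<tau> topology_eq openin_pullback_topology
  proof (intro allI iffI)
    fix S assume "\<exists>U. openin TH U \<and> S = \<eta> -` U \<inter> carrier G"
    then obtain U where U: "openin TH U" "S = \<eta> -` U \<inter> carrier G" by blast
    have "U \<subseteq> carrier H" using openin_subset[OF U(1)] sp by simp
    then have *: "e (\<eta> s) \<in> e ` U \<longleftrightarrow> \<eta> s \<in> U" if "s \<in> carrier G" for s
      using inj_on_image_mem_iff[OF inj im[OF that]] by simp
    have "S = (e \<circ> \<eta>) -` (e ` U) \<inter> carrier G"
    proof (rule Set.set_eqI)
      fix s show "s \<in> S \<longleftrightarrow> s \<in> (e \<circ> \<eta>) -` (e ` U) \<inter> carrier G"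
        using *[of s] unfolding U(2) by (cases "s \<in> carrier G") simp_all
    qed
    moreover have "openin TH' (e ` U)"
      using homeomorphic_imp_open_map[OF em] U(1) by (auto simp: open_map_def)
    ultimately show "\<exists>V. openin TH' V \<and> S = (e \<circ> \<eta>) -` V \<inter> carrier G" by blast
  next
    fix S assume "\<exists>V. openin TH' V \<and> S = (e \<circ> \<eta>) -` V \<inter> carrier G"
    then obtain V where V: "openin TH' V" "S = (e \<circ> \<eta>) -` V \<inter> carrier G" by blast
    have "openin TH {x \<in> carrier H. e x \<in> V}"
      using openin_continuous_map_preimage[OF homeomorphic_imp_continuous_map[OF em] V(1)] by (simp add: sp)
    moreover have "S = \<eta> -` {x \<in> carrier H. e x \<in> V} \<inter> carrier G" using V(2) im by auto
    ultimately show "\<exists>U. openin TH U \<and> S = \<eta> -` U \<inter> carrier G" by blast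
  qed
  have "TH' closure_of ((e \<circ> \<eta>) ` carrier G) = carrier H'"
  proof -
    have "TH' closure_of (e ` \<eta> ` carrier G) = e ` (TH closure_of (\<eta> ` carrier G))"
      by (rule homeomorphic_map_closure_of[OF em]) (use im sp in auto)
    then show ?thesis
      using dense homeomorphic_imp_surjective_map[OF em] sp sp' by (simp add: image_comp)
  qed
  then show thesis
    using that[of H' TH' e] H' ch pb eh em unfolding dense_pair_def by blast
qed

section \<open>Classification for the group of integer vectors\<close>

abbreviation (input) int_discrete :: "(int ^ 'n) topology" where
  "int_discrete \<equiv> discrete_topology UNIV"

lemma carrier_int_vec_group [simp]: "carrier int_vec_group = UNIV"
  by (simp add: int_vec_group_def)

lemma topological_group_int_vec_group: "topological_group (int_vec_group :: (int ^ 'n) monoid) int_discrete"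
  using locally_compact_group_discrete[OF group_int_vec_group[where 'n = 'n]]
  by (simp add: locally_compact_group_def)

lemma hom_int_vec_group_iff:
  "\<eta> \<in> hom int_vec_group H \<longleftrightarrow>
     (\<forall>x. \<eta> x \<in> carrier H) \<and> (\<forall>x y. \<eta> (x + y) = \<eta> x \<otimes>\<^bsub>H\<^esub> \<eta> y)"
  by (auto simp: hom_def int_vec_group_def)

lemma bohr_topology_in_lc_topologies:
  fixes L :: "(real ^ 'n) set"
  assumes "subspace L"
  shows "bohr_topology L \<in> lc_topologies int_vec_group int_discrete"
proof -
  have "continuous_hom int_vec_group int_discrete bohr_group bohr_group_top (bohr_embed L)"
    using bohr_embed_in[of L] bohr_embed_add[OF assms]
    by (auto simp: continuous_hom_def hom_int_vec_group_iff topspace_bohr_group_top)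
  from lc_topologies_universal[OF topological_group_int_vec_group locally_compact_group_bohr this]
  show ?thesis by (simp add: bohr_topology_def)
qed

text \<open>Local compactness of the target enters as a single precompact neighbourhood of
  \<open>0\<close>.\<close>

lemma lc_topology_coarser_bohr:
  fixes \<tau> :: "(int ^ 'n) topology"
  assumes "\<tau> \<in> lc_topologies int_vec_group int_discrete"
  shows "group_topology \<tau>" "coarser \<tau> (bohr_topology (bounded_functionals \<tau>))"
proof -
  obtain H :: "(int ^ 'n) set set monoid" and TH \<eta> where H: "locally_compact_group H TH"
    and \<eta>: "\<eta> \<in> hom int_vec_group H" and \<tau>: "\<tau> = pullback_topology UNIV \<eta> TH"
    using assms by (auto simp: lc_topologies_def continuous_hom_def)
  have tH: "topological_group H TH" and lc: "locally_compact_space TH"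
    using H by (auto simp: locally_compact_group_def)
  have im: "\<eta> x \<in> carrier H" and add: "\<eta> (x + y) = \<eta> x \<otimes>\<^bsub>H\<^esub> \<eta> y" for x y
    using \<eta> by (auto simp: hom_int_vec_group_iff)
  show gt: "group_topology \<tau>" unfolding \<tau> by (rule group_topology_pullback[OF tH im add])
  obtain U where "openin \<tau> U" "0 \<in> U" "precompact \<tau> U"
    unfolding \<tau> by (rule precompact_nbhd[OF tH im add lc])
  then show "coarser \<tau> (bohr_topology (bounded_functionals \<tau>))"
    by (rule coarser_bohr_bounded_functionals[OF gt])
qed

text \<open>Bounded functionals do not change under quotients, by properness.\<close>

lemma bohr_topology_nq:
  fixes L :: "(real ^ 'n) set"
  assumes L: "subspace L"
  shows "bohr_topology L \<in> nq_topologies int_vec_group int_discrete"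
  unfolding nq_topologies_def
proof (intro CollectI conjI notI bohr_topology_in_lc_topologies[OF L])
  let ?\<tau> = "bohr_topology L"
  assume "\<exists>\<tau>\<^sub>1\<in>lc_topologies int_vec_group int_discrete.
    lc_quotient int_vec_group int_discrete ?\<tau> \<tau>\<^sub>1 \<and> ?\<tau> \<noteq> \<tau>\<^sub>1"
  then obtain \<tau>\<^sub>1 where \<tau>\<^sub>1: "\<tau>\<^sub>1 \<in> lc_topologies int_vec_group int_discrete" "?\<tau> \<noteq> \<tau>\<^sub>1"
    and q: "lc_quotient int_vec_group int_discrete ?\<tau> \<tau>\<^sub>1" by blast
  from q obtain H :: "(int ^ 'n) set set monoid" and TH \<eta> and H\<^sub>1 :: "(int ^ 'n) set set monoid" and TH\<^sub>1 \<eta>\<^sub>1 f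
    where le: "coarser ?\<tau> \<tau>\<^sub>1" and dp: "dense_pair int_vec_group int_discrete ?\<tau> H TH \<eta>"
      and dp1: "dense_pair int_vec_group int_discrete \<tau>\<^sub>1 H\<^sub>1 TH\<^sub>1 \<eta>\<^sub>1"
      and f: "\<And>x. f (\<eta>\<^sub>1 x) = \<eta> x" and proper: "compact_preimages TH\<^sub>1 TH f"
    unfolding lc_quotient_def carrier_int_vec_group by (elim conjE exE) (rule that, auto)
  have H: "locally_compact_group H TH" "\<eta> \<in> hom int_vec_group H" "?\<tau> = pullback_topology UNIV \<eta> TH"
    and H1: "locally_compact_group H\<^sub>1 TH\<^sub>1" "\<eta>\<^sub>1 \<in> hom int_vec_group H\<^sub>1" "\<tau>\<^sub>1 = pullback_topology UNIV \<eta>\<^sub>1 TH\<^sub>1"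
    using dp dp1 by (auto simp: dense_pair_def continuous_hom_def)
  have t: "topological_group H TH" "locally_compact_space TH" "topological_group H\<^sub>1 TH\<^sub>1"
    using H(1) H1(1) by (auto simp: locally_compact_group_def)
  then have sp: "topspace TH\<^sub>1 = carrier H\<^sub>1" "\<one>\<^bsub>H\<^esub> \<in> topspace TH"
    by (auto simp: topological_group_def group.is_monoid)
  have im: "\<eta> x \<in> carrier H" "\<eta>\<^sub>1 x \<in> carrier H\<^sub>1"
    and add: "\<eta> (x + y) = \<eta> x \<otimes>\<^bsub>H\<^esub> \<eta> y" "\<eta>\<^sub>1 (x + y) = \<eta>\<^sub>1 x \<otimes>\<^bsub>H\<^sub>1\<^esub> \<eta>\<^sub>1 y" for x y
    using H(2) H1(2) by (auto simp: hom_int_vec_group_iff)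
  obtain W K where W: "openin TH W" "compactin TH K" "\<one>\<^bsub>H\<^esub> \<in> W" "W \<subseteq> K"
    using t(2) sp(2) unfolding locally_compact_space_def by blast
  \<comment> \<open>Properness makes the preimage of \<open>K\<close> compact in the finer group, so
    a neighbourhood of \<open>0\<close> for the coarser topology is precompact for
    \<open>\<tau>\<^sub>1\<close>, and every functional of \<open>\<tau>\<^sub>1\<close> is bounded
    on it.\<close>
  have "compactin TH\<^sub>1 {x \<in> topspace TH\<^sub>1. f x \<in> K}"
    using proper W(2) by (simp add: compact_preimages_def)
  from precompact_preimage[OF t(3) im(2) add(2) this]
  have pre: "precompact \<tau>\<^sub>1 (\<eta> -` W)"
    unfolding H1(3)[symmetric] by (rule precompact_subset) (use W(4) in \<open>auto simp: f sp im\<close>)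
  have "openin ?\<tau> (\<eta> -` W)" using W(1) unfolding H(3) openin_pullback_topology by auto
  moreover have "0 \<in> \<eta> -` W" using W(3) by (simp add: hom_0[OF t(1) im(1) add(1)])
  ultimately have "bounded_functionals \<tau>\<^sub>1 \<subseteq> bounded_functionals ?\<tau>"
    using bounded_functional_on_precompact[OF _ pre] unfolding bounded_functionals_def[of ?\<tau>] by blast
  then have "bounded_functionals \<tau>\<^sub>1 = L"
    using bounded_functionals_mono[OF le] bounded_functionals_bohr[OF L] by blast
  then have "coarser \<tau>\<^sub>1 ?\<tau>" using lc_topology_coarser_bohr(2)[OF \<tau>\<^sub>1(1)] by simp
  then show False using coarser_antisym[OF le] \<tau>\<^sub>1(2) by blast
qed

text \<open>The pair for the Bohr topology is realised as the closure of the diagonal image of \<open>\<int>\<^sup>n\<close> in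
  \<open>G\<^sub>\<tau>\<close> times the Bohr group, so that the connecting homomorphism is simply the first projection.\<close>

lemma lc_quotient_bohr:
  fixes \<tau> :: "(int ^ 'n) topology"
  assumes \<tau>: "\<tau> \<in> lc_topologies int_vec_group int_discrete"
  shows "lc_quotient int_vec_group int_discrete \<tau> (bohr_topology (bounded_functionals \<tau>))"
proof -
  define L where "L = bounded_functionals \<tau>"
  have le: "coarser \<tau> (bohr_topology L)" and gt: "group_topology \<tau>"
    using lc_topology_coarser_bohr[OF \<tau>] by (simp_all add: L_def)
  have L: "subspace L"
    unfolding L_def by (rule subspace_bounded_functionals[OF group_topology_topspace[OF gt]])
  obtain H :: "(int ^ 'n) set set monoid" and TH \<eta> where dp: "dense_pair int_vec_group int_discrete \<tau> H TH \<eta>"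
    using \<tau> lc_topologies_iff_dense_pair[OF topological_group_int_vec_group] by blast
  then have H: "locally_compact_group H TH" "\<eta> \<in> hom int_vec_group H" "\<tau> = pullback_topology UNIV \<eta> TH"
    by (auto simp: dense_pair_def continuous_hom_def)
  have tH: "topological_group H TH" and hd: "Hausdorff_space TH" and lc: "locally_compact_space TH"
    and sp: "topspace TH = carrier H"
    using H(1) by (auto simp: locally_compact_group_def topological_group_def)
  have im: "\<eta> x \<in> carrier H" and add: "\<eta> (x + y) = \<eta> x \<otimes>\<^bsub>H\<^esub> \<eta> y" for x y
    using H(2) by (auto simp: hom_int_vec_group_iff)
  define D where "D = H \<times>\<times> (bohr_group :: ((real ^ 'n) \<times> (real ^ 'n \<Rightarrow> complex)) monoid)"
  define TD where "TD = prod_topology TH (bohr_group_top :: ((real ^ 'n) \<times> (real ^ 'n \<Rightarrow> complex)) topology)"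
  define \<zeta> where "\<zeta> m = (\<eta> m, bohr_embed L m)" for m
  define C where "C = TD closure_of (range \<zeta>)"
  have lcD: "locally_compact_group D TD"
    unfolding D_def TD_def by (rule locally_compact_group_DirProd[OF H(1) locally_compact_group_bohr])
  have spD: "topspace TD = carrier D" and grD: "group D"
    using lcD by (auto simp: locally_compact_group_def topological_group_def)
  have \<zeta>_hom: "\<zeta> \<in> hom int_vec_group D"
    using im add bohr_embed_in[of L] bohr_embed_add[OF L]
    by (simp add: hom_int_vec_group_iff D_def \<zeta>_def)
  then have \<zeta>D: "range \<zeta> \<subseteq> carrier D" by (auto simp: hom_int_vec_group_iff)
  have "subgroup (\<zeta> ` carrier int_vec_group) D"
    using \<zeta>_hom group_int_vec_group grD
    by (intro group_hom.img_is_subgroup) (simp add: group_hom_def group_hom_axioms_def)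
  then have sgC: "subgroup C D"
    unfolding C_def by (intro subgroup_closure_of[OF lcD]) simp
  have clC: "closedin TD C" by (simp add: C_def)
  have CD: "C \<subseteq> carrier D" by (rule subgroup.subset[OF sgC])
  have \<zeta>C: "range \<zeta> \<subseteq> C" unfolding C_def using \<zeta>D spD by (simp add: closure_of_subset)
  define H\<^sub>1 where "H\<^sub>1 = D\<lparr>carrier := C\<rparr>"
  define T\<^sub>1 where "T\<^sub>1 = subtopology TD C"
  have lc1: "locally_compact_group H\<^sub>1 T\<^sub>1"
    unfolding H\<^sub>1_def T\<^sub>1_def by (rule locally_compact_group_closed_subgroup[OF lcD sgC clC])
  have sp1: "topspace T\<^sub>1 = C" using CD spD by (auto simp: T\<^sub>1_def)
  have \<zeta>_hom1: "\<zeta> \<in> hom int_vec_group H\<^sub>1"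
    using \<zeta>_hom \<zeta>C by (auto simp: hom_int_vec_group_iff H\<^sub>1_def)
  have \<zeta>_cont: "continuous_map \<sigma> T\<^sub>1 \<zeta> \<longleftrightarrow> continuous_map \<sigma> TH \<eta> \<and> continuous_map \<sigma> bohr_group_top (bohr_embed L)" for \<sigma>
    using \<zeta>C by (auto simp: T\<^sub>1_def continuous_map_in_subtopology TD_def continuous_map_pairwise \<zeta>_def o_def)
  have \<zeta>sp: "\<zeta> x \<in> topspace T\<^sub>1" for x using \<zeta>C sp1 by auto
  \<comment> \<open>Pulling back along \<open>\<zeta>\<close> gives the join of
    \<open>\<tau>\<close> and the Bohr topology; since \<open>\<tau>\<close> is coarser, the
    component \<open>\<eta>\<close> adds nothing.\<close>
  have pb: "bohr_topology L = pullback_topology UNIV \<zeta> T\<^sub>1"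
  proof (rule coarser_antisym)
    have top: "topspace (pullback_topology UNIV \<zeta> T\<^sub>1) = UNIV"
      using \<zeta>sp by (auto simp: topspace_pullback_topology)
    have "continuous_map (pullback_topology UNIV \<zeta> T\<^sub>1) T\<^sub>1 \<zeta>"
      using coarser_pullback_iff[of _ \<zeta> T\<^sub>1, OF top \<zeta>sp] by (simp add: coarser_def)
    then show "coarser (bohr_topology L) (pullback_topology UNIV \<zeta> T\<^sub>1)"
      unfolding \<zeta>_cont coarser_bohr_iff[OF top] by blast
    have "continuous_map (bohr_topology L) TH \<eta>"
      using le coarser_pullback_iff[OF topspace_bohr_topology, of \<eta> TH L] im sp H(3) by simp
    then show "coarser (pullback_topology UNIV \<zeta> T\<^sub>1) (bohr_topology L)"
      unfolding coarser_pullback_iff[of _ \<zeta> T\<^sub>1, OF topspace_bohr_topology \<zeta>sp] \<zeta>_cont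
      using continuous_map_bohr_embed by blast
  qed
  have "T\<^sub>1 closure_of (range \<zeta>) = C"
    using \<zeta>C by (simp add: T\<^sub>1_def closure_of_subtopology C_def Int_absorb1)
  then have "dense_pair int_vec_group int_discrete (bohr_topology L) H\<^sub>1 T\<^sub>1 \<zeta>"
    unfolding dense_pair_def continuous_hom_def
    using lc1 \<zeta>_hom1 \<zeta>sp pb by (auto simp: H\<^sub>1_def)
  then obtain H' :: "(int ^ 'n) set set monoid" and TH' e
    where dp': "dense_pair int_vec_group int_discrete (bohr_topology L) H' TH' (e \<circ> \<zeta>)"
      and eh: "e \<in> hom H\<^sub>1 H'" and em: "homeomorphic_map T\<^sub>1 TH' e"
    by (rule dense_pair_transport)
  obtain g where g: "homeomorphic_maps T\<^sub>1 TH' e g"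
    using em homeomorphic_map_maps by blast
  then have ge: "\<And>x. x \<in> C \<Longrightarrow> g (e x) = x" and cg: "continuous_map TH' T\<^sub>1 g"
    and eg: "\<And>y. y \<in> topspace TH' \<Longrightarrow> e (g y) = y" and gC: "\<And>y. y \<in> topspace TH' \<Longrightarrow> g y \<in> C"
    using sp1 by (auto simp: homeomorphic_maps_def continuous_map_def)
  have sp': "topspace TH' = carrier H'"
    using dp' by (simp add: dense_pair_def locally_compact_group_def topological_group_def)
  have eC: "e x \<in> topspace TH'" if "x \<in> C" for x
    using that em sp1 homeomorphic_imp_surjective_map by blast
  define f where "f = fst \<circ> g"
  have "f \<in> hom H' H"
  proof (rule homI)
    fix y assume "y \<in> carrier H'"
    then have "g y \<in> carrier D" using gC sp' CD by blast
    then show "f y \<in> carrier H" by (auto simp: f_def D_def)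
    fix y' assume "y' \<in> carrier H'"
    then have gg: "g y \<in> C" "g y' \<in> C" using gC sp' \<open>y \<in> carrier H'\<close> by auto
    then have "e (g y \<otimes>\<^bsub>D\<^esub> g y') = e (g y) \<otimes>\<^bsub>H'\<^esub> e (g y')"
      using eh by (simp add: hom_def H\<^sub>1_def)
    then have "g (y \<otimes>\<^bsub>H'\<^esub> y') = g (e (g y \<otimes>\<^bsub>D\<^esub> g y'))"
      using eg sp' \<open>y \<in> carrier H'\<close> \<open>y' \<in> carrier H'\<close> by simp
    also have "\<dots> = g y \<otimes>\<^bsub>D\<^esub> g y'"
      by (rule ge) (rule subgroup.m_closed[OF sgC gg])
    finally show "f (y \<otimes>\<^bsub>H'\<^esub> y') = f y \<otimes>\<^bsub>H\<^esub> f y'" by (simp add: f_def D_def mult_DirProd')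
  qed
  moreover have "continuous_map TH' TH f"
    using continuous_map_compose[OF cg, of TH fst]
    by (simp add: f_def T\<^sub>1_def TD_def continuous_map_from_subtopology continuous_map_fst)
  ultimately have cf: "continuous_hom H' TH' H TH f" by (simp add: continuous_hom_def)
  have fe: "f ((e \<circ> \<zeta>) x) = \<eta> x" for x
  proof -
    have "\<zeta> x \<in> C" using \<zeta>C by blast
    then have "f ((e \<circ> \<zeta>) x) = fst (\<zeta> x)" by (simp add: f_def ge)
    then show ?thesis by (simp add: \<zeta>_def)
  qed
  have "compact_preimages TH' TH f"
    unfolding compact_preimages_def
  proof (intro allI impI)
    fix K assume K: "compactin TH K"
    \<comment> \<open>Points of \<open>C\<close> are only limits of points \<open>\<zeta> m\<close>.
      The open set \<open>W\<close> ensures that the approximating \<open>\<zeta> m\<close> still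
      have \<open>\<eta> m\<close> in a compact set, where the projection to \<open>L\<close> is
      bounded.\<close>
    obtain W K' where W: "openin TH W" "compactin TH K'" "K \<subseteq> W" "W \<subseteq> K'"
      by (rule locally_compact_space_compact_nbhd[OF lc K])
    have pre: "precompact \<tau> {m. \<eta> m \<in> K'}"
      unfolding H(3) by (rule precompact_preimage[OF tH im add W(2)])
    have "bounded (orth_proj L ` rvec ` {m. \<eta> m \<in> K'})"
      by (rule bounded_orth_proj_image[OF L])
        (use bounded_functional_on_precompact[OF _ pre] in \<open>simp add: L_def image_image\<close>)
    then obtain R where R: "\<And>m. \<eta> m \<in> K' \<Longrightarrow> norm (orth_proj L (rvec m)) \<le> R"
      unfolding bounded_iff by auto
    define K\<^sub>1 where "K\<^sub>1 = {x \<in> C. fst x \<in> K}"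
    define Q where "Q = K \<times> (cball (0 :: real ^ 'n) R \<times> {z :: real ^ 'n \<Rightarrow> complex. \<forall>\<theta>. norm (z \<theta>) = 1})"
    have "K\<^sub>1 \<subseteq> Q"
    proof
      fix x assume x: "x \<in> K\<^sub>1"
      obtain h v z where hvz: "x = (h, v, z)" by (cases x) auto
      have xC: "(h, v, z) \<in> C" and hK: "h \<in> K" using x by (auto simp: K\<^sub>1_def hvz)
      then have z: "\<forall>\<theta>. norm (z \<theta>) = 1" using CD by (auto simp: D_def bohr_group_def)
      \<comment> \<open>Otherwise the open set \<open>N\<close> would contain some
        \<open>\<zeta> m\<close> with \<open>\<eta> m\<close> in \<open>W\<close> and projection
        longer than \<open>R\<close>.\<close>
      have "norm v \<le> R"
      proof (rule ccontr)
        assume v: "\<not> norm v \<le> R"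
        define N where "N = W \<times> {y \<in> topspace bohr_group_top. fst y \<in> - cball (0 :: real ^ 'n) R}"
        have "openin bohr_group_top {y \<in> topspace bohr_group_top. fst y \<in> - cball (0 :: real ^ 'n) R}"
          by (rule openin_continuous_map_preimage[where Y = euclidean])
            (auto simp: bohr_group_top_def continuous_map_fst)
        then have "openin TD N"
          using W(1) by (simp add: TD_def N_def openin_prod_Times_iff)
        moreover have "(h, v, z) \<in> N"
          using hK W(3) v z by (auto simp: N_def topspace_bohr_group_top bohr_group_def)
        moreover have "\<forall>T. (h, v, z) \<in> T \<and> openin TD T \<longrightarrow> (\<exists>y. y \<in> range \<zeta> \<and> y \<in> T)"
          using xC unfolding C_def in_closure_of by (rule conjunct2)
        ultimately obtain m where "\<zeta> m \<in> N" by blast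
        then show False using R[of m] W(4) by (auto simp: N_def \<zeta>_def bohr_embed_def)
      qed
      then show "x \<in> Q" using hK z by (simp add: Q_def hvz)
    qed
    moreover have "compactin TD Q"
      unfolding TD_def Q_def compactin_Times using K compactin_bohr_group by blast
    moreover have "closedin TD K\<^sub>1"
    proof -
      have "closedin TD {x \<in> topspace TD. fst x \<in> K}"
        by (rule closedin_continuous_map_preimage[OF _ compactin_imp_closedin[OF hd K]])
          (simp add: TD_def continuous_map_fst)
      moreover have "K\<^sub>1 = C \<inter> {x \<in> topspace TD. fst x \<in> K}" using CD spD by (auto simp: K\<^sub>1_def)
      ultimately show ?thesis using clC by (simp add: closedin_Int)
    qed
    ultimately have "compactin TD K\<^sub>1" by (metis closed_compactin)
    then have "compactin T\<^sub>1 K\<^sub>1" by (auto simp: T\<^sub>1_def compactin_subtopology K\<^sub>1_def)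
    then have "compactin TH' (e ` K\<^sub>1)"
      by (rule image_compactin[OF _ homeomorphic_imp_continuous_map[OF em]])
    moreover have "e ` K\<^sub>1 = {y \<in> topspace TH'. f y \<in> K}"
    proof (intro equalityI subsetI)
      fix y assume "y \<in> e ` K\<^sub>1"
      then show "y \<in> {y \<in> topspace TH'. f y \<in> K}" using ge eC by (auto simp: K\<^sub>1_def f_def)
    next
      fix y assume y: "y \<in> {y \<in> topspace TH'. f y \<in> K}"
      then have "g y \<in> K\<^sub>1" using gC by (simp add: K\<^sub>1_def f_def)
      then show "y \<in> e ` K\<^sub>1" using eg y by (metis (no_types, lifting) image_eqI mem_Collect_eq)
    qed
    ultimately show "compactin TH' {y \<in> topspace TH'. f y \<in> K}" by simp
  qed
  then show ?thesis
    unfolding lc_quotient_def L_def[symmetric] using le dp dp' cf fe by blast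
qed

text \<open>A member of \<open>nq_topologies\<close> equals every locally compact topology of which
  it is a quotient, and \<open>lc_quotient_bohr\<close> provides one.\<close>

lemma nq_topologies_int_vec_group:
  "nq_topologies (int_vec_group :: (int ^ 'n) monoid) int_discrete = bohr_topology ` {L. subspace L}"
proof (intro equalityI subsetI)
  fix \<tau> :: "(int ^ 'n) topology" assume nq: "\<tau> \<in> nq_topologies int_vec_group int_discrete"
  then have \<tau>: "\<tau> \<in> lc_topologies int_vec_group int_discrete" by (simp add: nq_topologies_def)
  have L: "subspace (bounded_functionals \<tau>)"
    by (rule subspace_bounded_functionals[OF group_topology_topspace[OF lc_topology_coarser_bohr(1)[OF \<tau>]]])
  have "\<tau> = bohr_topology (bounded_functionals \<tau>)"
    using nq bohr_topology_in_lc_topologies[OF L] lc_quotient_bohr[OF \<tau>] by (auto simp: nq_topologies_def)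
  then show "\<tau> \<in> bohr_topology ` {L. subspace L}" using L by blast
qed (auto intro: bohr_topology_nq)

theorem corollary6p4:
  shows "semilattice_isomorphic
           (nq_topologies (int_vec_group :: (int ^ 'n) monoid) (discrete_topology UNIV)) topology_join
           {L :: (real ^ 'n) set. subspace L} subspace_sum"
proof -
  let ?S = "{L :: (real ^ 'n) set. subspace L}"
  have sum: "subspace (subspace_sum L M)" if "subspace L" "subspace M" for L M :: "(real ^ 'n) set"
    unfolding subspace_sum_def by (rule subspace_sums[OF that])
  have assoc: "subspace_sum (subspace_sum L M) N = subspace_sum L (subspace_sum M N)" for L M N :: "(real ^ 'n) set"
    unfolding subspace_sum_def by (auto simp: add.assoc) (metis add.assoc)+
  have comm: "subspace_sum L M = subspace_sum M L" for L M :: "(real ^ 'n) set"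
    unfolding subspace_sum_def by (auto simp: add.commute) (metis add.commute)+
  have idem: "subspace_sum L L = L" if "subspace L" for L :: "(real ^ 'n) set"
    using subspace_add[OF that] subspace_0[OF that] by (force simp: subspace_sum_def)
  have S: "semilattice_on ?S subspace_sum"
    unfolding semilattice_on_def using sum assoc comm idem by blast
  have "semilattice_on (bohr_topology ` ?S) topology_join"
    unfolding semilattice_on_def
  proof (intro conjI ballI)
    fix x y assume "x \<in> bohr_topology ` ?S" "y \<in> bohr_topology ` ?S"
    then show "topology_join x y = topology_join y x"
      by (auto simp: topology_join_bohr intro!: arg_cong[OF comm])
  qed (auto simp: topology_join_bohr sum assoc idem)
  \<comment> \<open>The isomorphism is \<open>bounded_functionals\<close>, inverted by
    \<open>bohr_topology\<close>.\<close>
  moreover have "bij_betw bounded_functionals (bohr_topology ` ?S) ?S"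
    by (rule bij_betw_byWitness[where f' = bohr_topology]) (auto simp: bounded_functionals_bohr)
  moreover have "bounded_functionals (topology_join x y)
      = subspace_sum (bounded_functionals x) (bounded_functionals y)"
    if "x \<in> bohr_topology ` ?S" "y \<in> bohr_topology ` ?S" for x y
    using that sum by (auto simp: topology_join_bohr bounded_functionals_bohr)
  ultimately show ?thesis
    using S unfolding semilattice_isomorphic_def nq_topologies_int_vec_group by blast
qed

end
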